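(* Let $G=(V=[n],E)$ be a graph with maximal cliques $V_1,\dots,V_p$, let $f_0,f_1,\dots,f_N,g_1,\dots,g_m\in\mathbb{R}[x]=\mathbb{R}[x_1,\dots,x_n]$, let $a_1,\dots,a_N\in\mathbb{R}$, and let $$K=\{x\in\mathbb{R}^n:\ g_j(x)\ge 0\ (j\in[m]),\ x_ix_j=0\ (\{i,j\}\in\overline{E})\}.$$ Let $$\mathrm{val}=\inf_{\mu\in\mathscr{M}(\mathbb{R}^n)}\Big\{\int f_0\,d\mu:\ \int f_i\,d\mu=a_i\ (i\in[N]),\ \mathrm{Supp}(\mu)\subseteq K\Big\}.$$ For an integer $t\ge 1$, let $$\xi_t=\inf\{L(f_0):\ L\in\mathbb{R}[x]_{2t}^*,\ L(f_i)=a_i\ (i\in[N]),\ L\ge0\text{ on }\mathcal{M}(\mathbf{g})_{2t},\ L=0\text{ on }I_{E,2t}\}$$ and $$\xi^{\mathrm{isp}}_t=\inf\Big\{\sum_{k=1}^pL_k(f_{0|V_k}):\ L_k\in\mathbb{R}[x(V_k)]_{2t}^*\ (k\in[p]),\ \sum_{k=1}^pL_k(f_{i|V_k})=a_i\ (i\in[N]),\ L_k\ge0\text{ on }\mathcal{M}(\mathbf{g}_{|V_k})_{2t}\ (k\in[p])\Big\}.$$ Then, for any integer $t\ge 1$, we have $\xi_t\le\xi_t^{\mathrm{isp}}\le\mathrm{val}$. In addition, if $\mathcal{M}(\mathbf{g})$ is Archimedean and there exist scalars $z_0,z_1,\dots,z_N\in\mathbb{R}$ such that $\sum_{i=0}^Nz_if_i(x)>0$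 for all $x\in K$, then $\lim_{t\to\infty}\xi_t^{\mathrm{isp}}=\mathrm{val}$.
   Context: Notation: $[n]=\{1,\dots,n\}$. $E$ is a given set of pairs of distinct elements of $V=[n]$, and $\overline{E}$ is the set of pairs $\{i,j\}$ with $i,j\in V$, $i\ne j$, $\{i,j\}\notin E$. A clique of $G$ is a set of vertices any two distinct elements of which form an edge; maximal means inclusion-maximal. For $U\subseteq V$, $x(U)=\{x_i:i\in U\}$, and for a polynomial $f\in\mathbb{R}[x]$, $f_{|U}\in\mathbb{R}[x(U)]$ is obtained from $f$ by setting to zero all variables $x_i$ with $i\in V\setminus U$. $\mathbb{R}[x]_{2t}$ is the space of polynomials of degree at most $2t$ and $\mathbb{R}[x]_{2t}^*$ is the set of linear functionals $L:\mathbb{R}[x]_{2t}\to\mathbb{R}$ (similarly for $\mathbb{R}[x(V_k)]_{2t}$); writing $L(f_i)$ and $L_k(f_{i|V_k})$ presupposes that $t$ is such that these polynomials have degree at most $2t$. $\Sigma$ denotes the set of sums of squares of polynomials. With $\mathbf{g}=(g_1,\dots,g_m)$ and $g_0=1$, $$\mathcal{M}(\mathbf{g})_{2t}=\Big\{\sum_{j=0}^m\sigma_jg_j:\ \sigma_j\in\Sigma,\ \deg(\sigma_jg_j)\le2t\Big\},\qquad \mathcal{M}(\mathbf{g})=\Big\{\sum_{j=0}^m\sigma_jg_j:\ \sigma_j\in\Sigma\Big\},$$ and $\mathcal{M}(\mathbf{g}_{|V_k})_{2t}\subseteq\mathbb{R}[x(V_k)]_{2t}$ is defined in the same way from $\mathbf{g}_{|V_k}=((g_1)_{|V_k},\dots,(g_m)_{|V_k})$,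 with sums of squares in $\mathbb{R}[x(V_k)]$. $\mathcal{M}(\mathbf{g})$ is Archimedean if $R-\sum_{i=1}^nx_i^2\in\mathcal{M}(\mathbf{g})$ for some scalar $R>0$. The truncated ideal is $I_{E,2t}=\{\sum_{\{i,j\}\in\overline{E}}u_{ij}x_ix_j:\ u_{ij}\in\mathbb{R}[x]_{2t-2}\}$. $\mathscr{M}(\mathbb{R}^n)$ is the set of finite positive Borel measures on $\mathbb{R}^n$, and $\mathrm{Supp}(\mu)\subseteq K$ means that the support of $\mu$ is contained in $K$, equivalently $\int f\,d\mu=\int_K f\,d\mu$ for any Borel measurable function $f:\mathbb{R}^n\to\mathbb{R}$. The infimum over the empty set is $+\infty$.
   Formalization: The limit claim is proved under the extra condition that val < +∞ or that the scalars z_i can be chosen with z_0 ≥ 0; without it the claim fails for some infeasible moment problems (val = +∞ but ξ_t^isp = −∞ for all large t). *)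

theory Defs
  imports "HOL-Analysis.Analysis" "HOL-Library.Poly_Mapping"
begin

section \<open>Real polynomials in finitely many variables\<close>

text \<open>Real polynomials in variables indexed by \<open>'n\<close>: finitely supported coefficient functions on
  exponent vectors, with the convolution product of \<^theory>\<open>HOL-Library.Poly_Mapping\<close>.\<close>

type_synonym 'n rpoly = "('n \<Rightarrow>\<^sub>0 nat) \<Rightarrow>\<^sub>0 real"

definition pconst :: "real \<Rightarrow> 'n rpoly" where
  "pconst c = Poly_Mapping.single 0 c"

definition pvar :: "'n \<Rightarrow> 'n rpoly" where
  "pvar i = Poly_Mapping.single (Poly_Mapping.single i 1) 1"

definition peval :: "real ^ 'n \<Rightarrow> 'n rpoly \<Rightarrow> real" where
  "peval x p = (\<Sum>b\<in>Poly_Mapping.keys p. Poly_Mapping.lookup p b *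
      (\<Prod>i\<in>Poly_Mapping.keys b. (x $ i) ^ Poly_Mapping.lookup b i))"

text \<open>Total degree, with degree \<open>0\<close> for the zero polynomial. Degrees are only ever
  bounded from above by natural numbers, so this convention is harmless.\<close>

definition pdeg :: "'n rpoly \<Rightarrow> nat" where
  "pdeg p = Max (insert 0
     ((\<lambda>b. \<Sum>i\<in>Poly_Mapping.keys b. Poly_Mapping.lookup b i) ` Poly_Mapping.keys p))"

definition pvars :: "'n rpoly \<Rightarrow> 'n set" where
  "pvars p = (\<Union>b\<in>Poly_Mapping.keys p. Poly_Mapping.keys b)"

text \<open>\<open>polys U\<close> is $\mathbb{R}[x(U)]$, as a subring of the ring of all polynomials, and
  \<open>polys_le U d\<close> is $\mathbb{R}[x(U)]_d$.\<close>

definition polys :: "'n set \<Rightarrow> 'n rpoly set" where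
  "polys U = {p. pvars p \<subseteq> U}"

definition polys_le :: "'n set \<Rightarrow> nat \<Rightarrow> 'n rpoly set" where
  "polys_le U d = {p \<in> polys U. pdeg p \<le> d}"

text \<open>\<open>prestrict U p\<close> is $p_{|U}$, the result of substituting \<open>0\<close> for the variables outside \<open>U\<close>.\<close>

definition prestrict :: "'n set \<Rightarrow> 'n rpoly \<Rightarrow> 'n rpoly" where
  "prestrict U p = (\<Sum>b\<in>Poly_Mapping.keys p. pconst (Poly_Mapping.lookup p b) *
      (\<Prod>i\<in>Poly_Mapping.keys b. (if i \<in> U then pvar i else 0) ^ Poly_Mapping.lookup b i))"


section \<open>Sums of squares, quadratic modules, linear functionals\<close>

definition sos :: "'n set \<Rightarrow> 'n rpoly set" where
  "sos U = {\<Sum>q\<leftarrow>qs. q ^ 2 | qs. set qs \<subseteq> polys U}"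

text \<open>The multiplier \<open>\<sigma> 0\<close> belongs to \<open>g\<^sub>0 = 1\<close>; the value \<open>g 0\<close> is not used.\<close>

definition quad_module :: "'n set \<Rightarrow> nat \<Rightarrow> (nat \<Rightarrow> 'n rpoly) \<Rightarrow> 'n rpoly set" where
  "quad_module U m g = {\<sigma> 0 + (\<Sum>j=1..m. \<sigma> j * g j) | \<sigma>. \<forall>j\<in>{0..m}. \<sigma> j \<in> sos U}"

definition trunc_quad_module ::
    "'n set \<Rightarrow> nat \<Rightarrow> (nat \<Rightarrow> 'n rpoly) \<Rightarrow> nat \<Rightarrow> 'n rpoly set" where
  "trunc_quad_module U m g d = {\<sigma> 0 + (\<Sum>j=1..m. \<sigma> j * g j) | \<sigma>.
     (\<forall>j\<in>{0..m}. \<sigma> j \<in> sos U) \<and> pdeg (\<sigma> 0) \<le> d \<and> (\<forall>j\<in>{1..m}. pdeg (\<sigma> j * g j) \<le> d)}"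

definition archimedean_module :: "nat \<Rightarrow> (nat \<Rightarrow> 'n::finite rpoly) \<Rightarrow> bool" where
  "archimedean_module m g \<longleftrightarrow>
     (\<exists>R>0. pconst R - (\<Sum>i\<in>UNIV. pvar i ^ 2) \<in> quad_module UNIV m g)"

text \<open>A linear functional on $\mathbb{R}[x(U)]_d$ is represented by a function on all
  polynomials; its values outside \<open>polys_le U d\<close> are irrelevant and unconstrained.\<close>

definition functional_on :: "'n set \<Rightarrow> nat \<Rightarrow> ('n rpoly \<Rightarrow> real) \<Rightarrow> bool" where
  "functional_on U d L \<longleftrightarrow>
     (\<forall>p\<in>polys_le U d. \<forall>q\<in>polys_le U d. L (p + q) = L p + L q) \<and>
     (\<forall>c. \<forall>p\<in>polys_le U d. L (pconst c * p) = c * L p)"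


section \<open>Graphs on the index set of the variables\<close>

definition clique :: "'n set set \<Rightarrow> 'n set \<Rightarrow> bool" where
  "clique E C \<longleftrightarrow> (\<forall>i\<in>C. \<forall>j\<in>C. i \<noteq> j \<longrightarrow> {i, j} \<in> E)"

definition max_cliques :: "'n set set \<Rightarrow> 'n set set" where
  "max_cliques E = {C. clique E C \<and> (\<forall>D. clique E D \<and> C \<subseteq> D \<longrightarrow> D = C)}"

definition nonedges :: "'n set set \<Rightarrow> 'n set set" where
  "nonedges E = {{i, j} | i j. i \<noteq> j \<and> {i, j} \<notin> E}"

text \<open>\<open>trunc_edge_ideal E d\<close> is $I_{E,d}$; for \<open>e = {i, j}\<close> the product over \<open>e\<close> is $x_i x_j$.\<close>

definition trunc_edge_ideal :: "'n set set \<Rightarrow> nat \<Rightarrow> 'n rpoly set" where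
  "trunc_edge_ideal E d = {\<Sum>e\<in>nonedges E. u e * (\<Prod>i\<in>e. pvar i) | u.
     \<forall>e\<in>nonedges E. u e \<in> polys_le UNIV (d - 2)}"


section \<open>The moment problem and its relaxations\<close>

definition feas_set :: "'n::finite set set \<Rightarrow> nat \<Rightarrow> (nat \<Rightarrow> 'n rpoly) \<Rightarrow> (real ^ 'n) set" where
  "feas_set E m g = {x. (\<forall>j\<in>{1..m}. 0 \<le> peval x (g j)) \<and>
     (\<forall>i j. i \<noteq> j \<longrightarrow> {i, j} \<notin> E \<longrightarrow> x $ i * x $ j = 0)}"

definition msupport :: "'a::topological_space measure \<Rightarrow> 'a set" where
  "msupport \<mu> = {x. \<forall>S. open S \<longrightarrow> x \<in> S \<longrightarrow> 0 < emeasure \<mu> S}"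

text \<open>Integrability of \<open>f 0, \<dots>, f N\<close> is required explicitly, because the Bochner integral of a
  non-integrable function is \<open>0\<close> by convention. The infimum of the empty set is \<open>\<infinity>\<close>
  in \<^typ>\<open>ereal\<close>.\<close>

definition gmp_val :: "'n::finite set set \<Rightarrow> nat \<Rightarrow> (nat \<Rightarrow> 'n rpoly) \<Rightarrow>
    nat \<Rightarrow> (nat \<Rightarrow> 'n rpoly) \<Rightarrow> (nat \<Rightarrow> real) \<Rightarrow> ereal" where
  "gmp_val E m g N f a = Inf {ereal (\<integral>x. peval x (f 0) \<partial>\<mu>) | \<mu> :: (real ^ 'n) measure.
     sets \<mu> = sets borel \<and> finite_measure \<mu> \<and>
     (\<forall>i\<in>{0..N}. integrable \<mu> (\<lambda>x. peval x (f i))) \<and>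
     (\<forall>i\<in>{1..N}. (\<integral>x. peval x (f i) \<partial>\<mu>) = a i) \<and>
     msupport \<mu> \<subseteq> feas_set E m g}"

definition xi :: "'n::finite set set \<Rightarrow> nat \<Rightarrow> (nat \<Rightarrow> 'n rpoly) \<Rightarrow>
    nat \<Rightarrow> (nat \<Rightarrow> 'n rpoly) \<Rightarrow> (nat \<Rightarrow> real) \<Rightarrow> nat \<Rightarrow> ereal" where
  "xi E m g N f a t = Inf {ereal (L (f 0)) | L.
     functional_on UNIV (2 * t) L \<and>
     (\<forall>i\<in>{1..N}. L (f i) = a i) \<and>
     (\<forall>q\<in>trunc_quad_module UNIV m g (2 * t). 0 \<le> L q) \<and>
     (\<forall>q\<in>trunc_edge_ideal E (2 * t). L q = 0)}"

definition xi_isp :: "nat \<Rightarrow> (nat \<Rightarrow> 'n::finite set) \<Rightarrow> nat \<Rightarrow> (nat \<Rightarrow> 'n rpoly) \<Rightarrow>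
    nat \<Rightarrow> (nat \<Rightarrow> 'n rpoly) \<Rightarrow> (nat \<Rightarrow> real) \<Rightarrow> nat \<Rightarrow> ereal" where
  "xi_isp p V m g N f a t = Inf {ereal (\<Sum>k=1..p. L k (prestrict (V k) (f 0))) | L.
     (\<forall>k\<in>{1..p}. functional_on (V k) (2 * t) (L k)) \<and>
     (\<forall>i\<in>{1..N}. (\<Sum>k=1..p. L k (prestrict (V k) (f i))) = a i) \<and>
     (\<forall>k\<in>{1..p}. \<forall>q\<in>trunc_quad_module (V k) m (\<lambda>j. prestrict (V k) (g j)) (2 * t).
        0 \<le> L k q)}"

end

theory Submission
  imports Defs
begin

text \<open>
  Write \<open>K\<close> for the feasible set. Its points are exactly those \<open>x\<close> that satisfy all \<open>g j \<ge> 0\<close> and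
  whose support is a clique, hence lies in one of the maximal cliques \<open>V k\<close>; this is what makes the
  sparse relaxation \<open>xi_isp\<close> comparable to the moment problem.

  \<^emph>\<open>Inequalities.\<close> Restricting a polynomial to each \<open>V k\<close> and adding up turns a family \<open>L k\<close> into
  one functional, which vanishes on the edge ideal because every non-edge loses a variable in each
  \<open>V k\<close> (\<open>xi_le_xi_isp\<close>). Conversely, a measure on \<open>K\<close> should be split according to a maximal
  clique containing the support of each point. A measure for which only \<open>f 0, \<dots>, f N\<close> are integrable
  does not define functionals on all polynomials of degree at most \<open>2 * t\<close>. It is therefore first replaced by
  a finitely atomic one with the same integrals (Tchakaloff's theorem, \<open>tchakaloff\<close> and
  \<open>gmp_val_eq_atomic\<close>), for which the splitting is a regrouping of a finite sum
  (\<open>xi_isp_le_gmp_val\<close>).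

  \<^emph>\<open>Convergence.\<close> The argument is by duality and needs no limits of functionals. Fix a real
  \<open>c < gmp_val\<close>. The vectors \<open>(f 0 x, \<dots>, f N x)\<close> with \<open>x \<in> K\<close>, together with \<open>(1, 0, \<dots>, 0)\<close> and
  \<open>- (c, a 1, \<dots>, a N)\<close>, form a compact set, since \<open>K\<close> is closed and the Archimedean property
  bounds it. A vanishing convex combination of them would give an
  atomic measure that is feasible with objective at most \<open>c\<close>, or a nonzero measure on \<open>K\<close> that can be
  added to a feasible one without limit to drive the objective to \<open>-\<infinity>\<close>, or would contradict
  positivity of \<open>\<Sum>i. z i * f i\<close> on \<open>K\<close>
  (\<open>moment_ray_excluded\<close>). So some linear form is strictly positive on all these vectors
  (\<open>gordan_compact\<close>), which after normalisation says that \<open>h = f 0 + (\<Sum>i. y i * f i)\<close> is positive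
  on \<open>K\<close> and \<open>c < - (\<Sum>i. y i * a i)\<close> (\<open>strict_dual_certificate\<close>). Points supported in \<open>V k\<close> with
  all \<open>g j \<ge> 0\<close> lie in \<open>K\<close>, so Putinar's theorem applies on each clique: \<open>h\<close> restricted to \<open>V k\<close> lies in the
  quadratic module of the restricted \<open>g j\<close> (\<open>putinar_prestrict\<close>). Once \<open>t\<close> exceeds the degrees of
  these finitely many certificates, every feasible family satisfies
  \<open>\<Sum>k. L k (prestrict (V k) h) \<ge> 0\<close>, that is, its objective is at least \<open>- (\<Sum>i. y i * a i) > c\<close> (\<open>eventually_xi_isp_ge\<close>).

  \<^emph>\<open>Putinar's theorem\<close> is proved algebraically. In an Archimedean quadratic module \<open>Q\<close>, an
  identity \<open>s * h = 1 + q\<close> with \<open>s\<close> a sum of squares and \<open>q \<in> Q\<close> already forces \<open>h \<in> Q\<close>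
  (\<open>archimedean_divide\<close>). If no such identity exists, then \<open>Q\<close> together with \<open>- h\<close> generates a
  proper quadratic module; a maximal proper one above it is total, and the cuts it
  makes in the real line define a real character, that is, a point evaluation, that is nonnegative on
  \<open>Q\<close> and nonpositive at \<open>h\<close> (\<open>character_of_total_module\<close>, \<open>archimedean_positivstellensatz\<close>).
\<close>

section \<open>Polynomial substitution as a ring homomorphism\<close>

text \<open>A commutative \<open>\<real>\<close>-algebra given by its structure map \<open>c\<close>. Evaluation at a point (algebra \<open>\<real>\<close>)
  and restriction to a set of variables (algebra of polynomials) are then two instances of one
  substitution homomorphism.\<close>

locale real_scalars =
  fixes c :: "real \<Rightarrow> 'a::comm_ring_1"
  assumes c_one [simp]: "c 1 = 1"
    and c_add: "c (r + s) = c r + c s"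
    and c_mult: "c (r * s) = c r * c s"
begin

lemma c_zero [simp]: "c 0 = 0"
  using c_add[of 0 0] by simp

lemma c_minus: "c (- r) = - c r"
  using c_add[of r "- r"] by (simp add: eq_neg_iff_add_eq_0 add.commute)

lemma c_diff: "c (r - s) = c r - c s"
  using c_add[of r "- s"] by (simp add: c_minus)

end

definition monom_eval :: "('n \<Rightarrow> 'a::comm_ring_1) \<Rightarrow> ('n \<Rightarrow>\<^sub>0 nat) \<Rightarrow> 'a" where
  "monom_eval \<phi> b = (\<Prod>i\<in>Poly_Mapping.keys b. \<phi> i ^ Poly_Mapping.lookup b i)"

lemma monom_eval_superset:
  assumes "finite B" "Poly_Mapping.keys b \<subseteq> B"
  shows "monom_eval \<phi> b = (\<Prod>i\<in>B. \<phi> i ^ Poly_Mapping.lookup b i)"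
  unfolding monom_eval_def
  by (rule prod.mono_neutral_left) (use assms in \<open>auto simp: in_keys_iff\<close>)

lemma monom_eval_zero [simp]: "monom_eval \<phi> 0 = 1"
  by (simp add: monom_eval_def)

lemma monom_eval_add: "monom_eval \<phi> (a + b) = monom_eval \<phi> a * monom_eval \<phi> b"
proof -
  let ?B = "Poly_Mapping.keys a \<union> Poly_Mapping.keys b"
  have "monom_eval \<phi> (a + b) = (\<Prod>i\<in>?B. \<phi> i ^ Poly_Mapping.lookup (a + b) i)"
    by (rule monom_eval_superset) (use keys_add[of a b] in auto)
  also have "\<dots> = (\<Prod>i\<in>?B. \<phi> i ^ Poly_Mapping.lookup a i) * (\<Prod>i\<in>?B. \<phi> i ^ Poly_Mapping.lookup b i)"
    by (simp add: lookup_add power_add prod.distrib)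
  also have "\<dots> = monom_eval \<phi> a * monom_eval \<phi> b"
    by (simp add: monom_eval_superset[of ?B])
  finally show ?thesis .
qed

lemma sum_singles: "(\<Sum>b\<in>Poly_Mapping.keys p. Poly_Mapping.single b (Poly_Mapping.lookup p b)) = p"
proof (rule poly_mapping_eqI)
  fix k
  show "Poly_Mapping.lookup (\<Sum>b\<in>Poly_Mapping.keys p. Poly_Mapping.single b (Poly_Mapping.lookup p b)) k
        = Poly_Mapping.lookup p k"
    by (simp add: lookup_sum lookup_single when_def sum.delta in_keys_iff)
qed

context real_scalars
begin

definition psubst :: "('n \<Rightarrow> 'a) \<Rightarrow> 'n rpoly \<Rightarrow> 'a" where
  "psubst \<phi> p = (\<Sum>b\<in>Poly_Mapping.keys p. c (Poly_Mapping.lookup p b) * monom_eval \<phi> b)"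

lemma psubst_superset:
  assumes "finite B" "Poly_Mapping.keys p \<subseteq> B"
  shows "psubst \<phi> p = (\<Sum>b\<in>B. c (Poly_Mapping.lookup p b) * monom_eval \<phi> b)"
  unfolding psubst_def
  by (rule sum.mono_neutral_left) (use assms in \<open>auto simp: in_keys_iff\<close>)

lemma psubst_add: "psubst \<phi> (p + q) = psubst \<phi> p + psubst \<phi> q"
proof -
  let ?B = "Poly_Mapping.keys p \<union> Poly_Mapping.keys q"
  have "psubst \<phi> (p + q) = (\<Sum>b\<in>?B. c (Poly_Mapping.lookup (p + q) b) * monom_eval \<phi> b)"
    by (rule psubst_superset) (use keys_add[of p q] in auto)
  then show ?thesis
    by (simp add: psubst_superset[of ?B] lookup_add c_add distrib_right sum.distrib)
qed

lemma psubst_zero [simp]: "psubst \<phi> 0 = 0"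
  by (simp add: psubst_def)

lemma psubst_sum: "psubst \<phi> (sum F A) = (\<Sum>x\<in>A. psubst \<phi> (F x))"
  by (induction A rule: infinite_finite_induct) (simp_all add: psubst_add)

lemma psubst_single: "psubst \<phi> (Poly_Mapping.single b r) = c r * monom_eval \<phi> b"
  using psubst_superset[of "{b}" "Poly_Mapping.single b r" \<phi>] by simp

lemma psubst_mult: "psubst \<phi> (p * q) = psubst \<phi> p * psubst \<phi> q"
proof -
  let ?P = "Poly_Mapping.keys p" and ?Q = "Poly_Mapping.keys q"
  have "psubst \<phi> (p * q) =
     psubst \<phi> ((\<Sum>a\<in>?P. Poly_Mapping.single a (Poly_Mapping.lookup p a)) *
       (\<Sum>b\<in>?Q. Poly_Mapping.single b (Poly_Mapping.lookup q b)))"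
    by (simp only: sum_singles)
  also have "\<dots> = (\<Sum>a\<in>?P. \<Sum>b\<in>?Q. c (Poly_Mapping.lookup p a * Poly_Mapping.lookup q b) * monom_eval \<phi> (a + b))"
    by (simp only: sum_product psubst_sum psubst_single mult_single)
  also have "\<dots> = psubst \<phi> p * psubst \<phi> q"
    unfolding psubst_def sum_product
    by (intro sum.cong refl) (simp add: monom_eval_add c_mult mult.assoc mult.left_commute)
  finally show ?thesis .
qed

lemma psubst_pconst [simp]: "psubst \<phi> (pconst r) = c r"
  by (simp add: pconst_def psubst_single)

lemma psubst_one [simp]: "psubst \<phi> 1 = 1"
  by (simp add: psubst_single flip: single_one)

lemma psubst_power: "psubst \<phi> (p ^ k) = psubst \<phi> p ^ k"
  by (induction k) (simp_all add: psubst_mult)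

lemma psubst_prod: "psubst \<phi> (prod F A) = (\<Prod>x\<in>A. psubst \<phi> (F x))"
  by (induction A rule: infinite_finite_induct) (simp_all add: psubst_mult)

lemma psubst_pvar [simp]: "psubst \<phi> (pvar i) = \<phi> i"
  by (simp add: pvar_def psubst_single monom_eval_def)

lemma psubst_diff: "psubst \<phi> (p - q) = psubst \<phi> p - psubst \<phi> q"
  using psubst_add[of \<phi> "p - q" q] by simp

end

interpretation pconst: real_scalars "pconst :: real \<Rightarrow> 'n rpoly"
  by unfold_locales (simp_all add: pconst_def single_add mult_single)

interpretation ident: real_scalars "id :: real \<Rightarrow> real"
  by unfold_locales simp_all

lemma pvar_power: "pvar i ^ k = Poly_Mapping.single (Poly_Mapping.single i k) 1"
proof (induction k)
  case 0
  show ?case by (simp only: power_0 single_zero single_one)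
next
  case (Suc k)
  have "pvar i ^ Suc k = pvar i * pvar i ^ k" by (rule power_Suc)
  also have "\<dots> = Poly_Mapping.single (Poly_Mapping.single i 1 + Poly_Mapping.single i k) (1 * 1)"
    unfolding Suc.IH unfolding pvar_def mult_single by (rule refl)
  also have "\<dots> = Poly_Mapping.single (Poly_Mapping.single i (Suc k)) 1"
    by (simp only: single_add[symmetric] plus_1_eq_Suc mult_1)
  finally show ?case .
qed

lemma prod_single_one:
  "(\<Prod>i\<in>A. Poly_Mapping.single (e i) (1::real)) = Poly_Mapping.single (\<Sum>i\<in>A. e i) 1"
  by (induction A rule: infinite_finite_induct) (simp_all add: mult_single)

lemma monom_eval_pvar: "monom_eval pvar b = Poly_Mapping.single b (1::real)"
  by (simp only: monom_eval_def pvar_power prod_single_one sum_singles)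

lemma psubst_pvar_ident: "pconst.psubst pvar p = p"
  by (simp add: pconst.psubst_def monom_eval_pvar pconst_def mult_single sum_singles)

text \<open>Polynomials are generated by constants and variables, so an algebra homomorphism is
  determined by its values on the variables. This identifies abstract characters with points.\<close>

lemma (in real_scalars) alg_hom_eq_psubst:
  fixes H :: "'n rpoly \<Rightarrow> 'a"
  assumes add: "\<And>p q. H (p + q) = H p + H q" and mult: "\<And>p q. H (p * q) = H p * H q"
    and const: "\<And>r. H (pconst r) = c r"
  shows "H p = psubst (\<lambda>i. H (pvar i)) p"
proof -
  have one: "H 1 = 1" using const[of 1] by (simp only: pconst.c_one c_one)
  have zero: "H 0 = 0" using const[of 0] by (simp only: pconst.c_zero c_zero)
  have sum: "H (sum F A) = (\<Sum>x\<in>A. H (F x))" for F :: "('n \<Rightarrow>\<^sub>0 nat) \<Rightarrow> 'n rpoly" and A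
    by (induction A rule: infinite_finite_induct) (simp_all add: zero add)
  have prod: "H (prod F A) = (\<Prod>x\<in>A. H (F x))" for F :: "'n \<Rightarrow> 'n rpoly" and A
    by (induction A rule: infinite_finite_induct) (simp_all add: one mult)
  have power: "H (q ^ k) = H q ^ k" for q k
    by (induction k) (simp_all only: power_0 power_Suc mult one)
  have "H p = H (pconst.psubst pvar p)"
    by (simp only: psubst_pvar_ident)
  also have "\<dots> = psubst (\<lambda>i. H (pvar i)) p"
    unfolding pconst.psubst_def psubst_def monom_eval_def by (simp only: sum prod power mult const)
  finally show ?thesis .
qed

lemma peval_eq_psubst: "peval x = ident.psubst (\<lambda>i. x $ i)"
  by (rule ext) (simp add: peval_def ident.psubst_def monom_eval_def)

lemma prestrict_eq_psubst: "prestrict U = pconst.psubst (\<lambda>i. if i \<in> U then pvar i else 0)"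
  by (rule ext) (simp only: prestrict_def pconst.psubst_def monom_eval_def)

lemmas peval_hom = ident.psubst_add[of "\<lambda>i. x $ i" for x, folded peval_eq_psubst]
  ident.psubst_diff[of "\<lambda>i. x $ i" for x, folded peval_eq_psubst]
  ident.psubst_mult[of "\<lambda>i. x $ i" for x, folded peval_eq_psubst]
  ident.psubst_power[of "\<lambda>i. x $ i" for x, folded peval_eq_psubst]
  ident.psubst_sum[of "\<lambda>i. x $ i" for x, folded peval_eq_psubst]
  ident.psubst_pconst[of "\<lambda>i. x $ i" for x, folded peval_eq_psubst, unfolded id_apply]
  ident.psubst_one[of "\<lambda>i. x $ i" for x, folded peval_eq_psubst]
  ident.psubst_zero[of "\<lambda>i. x $ i" for x, folded peval_eq_psubst]
  ident.psubst_pvar[of "\<lambda>i. x $ i" for x, folded peval_eq_psubst]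

lemmas prestrict_hom =
  pconst.psubst_add[of "\<lambda>i. if i \<in> U then pvar i else 0" for U, folded prestrict_eq_psubst]
  pconst.psubst_diff[of "\<lambda>i. if i \<in> U then pvar i else 0" for U, folded prestrict_eq_psubst]
  pconst.psubst_mult[of "\<lambda>i. if i \<in> U then pvar i else 0" for U, folded prestrict_eq_psubst]
  pconst.psubst_power[of "\<lambda>i. if i \<in> U then pvar i else 0" for U, folded prestrict_eq_psubst]
  pconst.psubst_sum[of "\<lambda>i. if i \<in> U then pvar i else 0" for U, folded prestrict_eq_psubst]
  pconst.psubst_prod[of "\<lambda>i. if i \<in> U then pvar i else 0" for U, folded prestrict_eq_psubst]
  pconst.psubst_pconst[of "\<lambda>i. if i \<in> U then pvar i else 0" for U, folded prestrict_eq_psubst]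
  pconst.psubst_one[of "\<lambda>i. if i \<in> U then pvar i else 0" for U, folded prestrict_eq_psubst]
  pconst.psubst_zero[of "\<lambda>i. if i \<in> U then pvar i else 0" for U, folded prestrict_eq_psubst]
  pconst.psubst_pvar[of "\<lambda>i. if i \<in> U then pvar i else 0" for U, folded prestrict_eq_psubst]

lemma peval_sum_list: "peval x (sum_list ps) = (\<Sum>p\<leftarrow>ps. peval x p)"
  by (induction ps) (simp_all add: peval_hom)

lemma prestrict_sum_list: "prestrict U (sum_list ps) = (\<Sum>p\<leftarrow>ps. prestrict U p)"
  by (induction ps) (simp_all add: prestrict_hom)

text \<open>Restriction to \<open>U\<close> deletes the monomials that involve a variable outside \<open>U\<close>. In this form it is
  clear that restriction cannot raise the degree and is idempotent.\<close>

lemma lookup_prestrict: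
  "Poly_Mapping.lookup (prestrict U p) b =
     (if Poly_Mapping.keys b \<subseteq> U then Poly_Mapping.lookup p b else 0)"
proof -
  let ?\<phi> = "\<lambda>i. if i \<in> U then pvar i else 0"
  have mono: "monom_eval ?\<phi> d = (if Poly_Mapping.keys d \<subseteq> U then Poly_Mapping.single d 1 else 0)"
    for d :: "'a \<Rightarrow>\<^sub>0 nat"
  proof (cases "Poly_Mapping.keys d \<subseteq> U")
    case True
    then have "monom_eval ?\<phi> d = monom_eval pvar d"
      unfolding monom_eval_def by (intro prod.cong) auto
    then show ?thesis using True by (simp add: monom_eval_pvar)
  next
    case False
    then obtain i where "i \<in> Poly_Mapping.keys d" "i \<notin> U" by auto
    then have "\<exists>i\<in>Poly_Mapping.keys d. ?\<phi> i ^ Poly_Mapping.lookup d i = 0"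
      by (intro bexI[of _ i]) (auto simp: in_keys_iff power_0_left)
    then show ?thesis using False
      unfolding monom_eval_def by (simp add: prod_zero)
  qed
  have "prestrict U p = (\<Sum>d\<in>Poly_Mapping.keys p.
      if Poly_Mapping.keys d \<subseteq> U then Poly_Mapping.single d (Poly_Mapping.lookup p d) else 0)"
    unfolding prestrict_eq_psubst pconst.psubst_def mono
    by (rule sum.cong) (simp_all add: pconst_def mult_single)
  then have "Poly_Mapping.lookup (prestrict U p) b = (\<Sum>d\<in>Poly_Mapping.keys p. Poly_Mapping.lookup
      (if Poly_Mapping.keys d \<subseteq> U then Poly_Mapping.single d (Poly_Mapping.lookup p d) else 0) b)"
    by (simp only: lookup_sum)
  also have "\<dots> = (\<Sum>d\<in>Poly_Mapping.keys p.
      if d = b then (if Poly_Mapping.keys b \<subseteq> U then Poly_Mapping.lookup p b else 0) else 0)"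
    by (intro sum.cong refl) (simp add: lookup_single when_def)
  also have "\<dots> = (if Poly_Mapping.keys b \<subseteq> U then Poly_Mapping.lookup p b else 0)"
    by (simp add: sum.delta in_keys_iff)
  finally show ?thesis .
qed

lemma keys_prestrict:
  "Poly_Mapping.keys (prestrict U p) = {b \<in> Poly_Mapping.keys p. Poly_Mapping.keys b \<subseteq> U}"
  by (rule set_eqI)
    (simp add: in_keys_iff[of _ p] in_keys_iff[of _ "prestrict U p"] lookup_prestrict)

lemma prestrict_in_polys: "prestrict U p \<in> polys U"
  unfolding polys_def pvars_def mem_Collect_eq keys_prestrict by blast

text \<open>Reduces closure properties of \<open>polys U\<close> to the homomorphism property of restriction.\<close>

lemma polys_iff_prestrict: "p \<in> polys U \<longleftrightarrow> prestrict U p = p"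
proof
  assume p: "p \<in> polys U"
  show "prestrict U p = p"
  proof (rule poly_mapping_eqI)
    fix b
    have "Poly_Mapping.keys b \<subseteq> U" if "b \<in> Poly_Mapping.keys p"
      using p that unfolding polys_def pvars_def by blast
    then show "Poly_Mapping.lookup (prestrict U p) b = Poly_Mapping.lookup p b"
      by (auto simp: lookup_prestrict in_keys_iff)
  qed
next
  assume "prestrict U p = p"
  then show "p \<in> polys U" using prestrict_in_polys[of U p] by simp
qed

lemma pdeg_le_iff:
  "pdeg p \<le> d \<longleftrightarrow> (\<forall>b\<in>Poly_Mapping.keys p.
     (\<Sum>i\<in>Poly_Mapping.keys b. Poly_Mapping.lookup b i) \<le> d)"
  unfolding pdeg_def by (subst Max_le_iff) auto

lemma pdeg_prestrict: "pdeg p \<le> d \<Longrightarrow> pdeg (prestrict U p) \<le> d"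
  by (auto simp: pdeg_le_iff keys_prestrict)

lemma pdeg_add: "pdeg p \<le> d \<Longrightarrow> pdeg q \<le> d \<Longrightarrow> pdeg (p + q) \<le> d"
  using keys_add[of p q] by (auto simp: pdeg_le_iff)

lemma lookup_pconst_mult: "Poly_Mapping.lookup (pconst r * p) b = r * Poly_Mapping.lookup p b"
proof -
  have "pconst r * p = pconst r * (\<Sum>b\<in>Poly_Mapping.keys p. Poly_Mapping.single b (Poly_Mapping.lookup p b))"
    by (simp add: sum_singles)
  also have "\<dots> = (\<Sum>b\<in>Poly_Mapping.keys p. Poly_Mapping.single b (r * Poly_Mapping.lookup p b))"
    by (simp add: sum_distrib_left pconst_def mult_single)
  finally show ?thesis
    by (simp add: lookup_sum lookup_single when_def sum.delta in_keys_iff)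
qed

lemma pdeg_pconst_mult: "pdeg p \<le> d \<Longrightarrow> pdeg (pconst r * p) \<le> d"
  by (auto simp: pdeg_le_iff in_keys_iff lookup_pconst_mult)

lemma polys_le_prestrict [intro]: "pdeg p \<le> d \<Longrightarrow> prestrict U p \<in> polys_le U d"
  by (simp add: polys_le_def pdeg_prestrict prestrict_in_polys)

lemma polys_le_add: "p \<in> polys_le U d \<Longrightarrow> q \<in> polys_le U d \<Longrightarrow> p + q \<in> polys_le U d"
  by (simp add: polys_le_def pdeg_add polys_iff_prestrict prestrict_hom)

lemma polys_le_scale: "p \<in> polys_le U d \<Longrightarrow> pconst r * p \<in> polys_le U d"
  by (simp add: polys_le_def pdeg_pconst_mult polys_iff_prestrict prestrict_hom)

text \<open>At a point supported in \<open>U\<close>, setting the other variables to zero changes nothing.\<close>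

lemma peval_prestrict:
  assumes "\<And>i. i \<notin> U \<Longrightarrow> x $ i = 0"
  shows "peval x (prestrict U p) = peval x p"
proof -
  have "peval x (prestrict U p) = ident.psubst (\<lambda>i. peval x (prestrict U (pvar i))) p"
    by (rule ident.alg_hom_eq_psubst) (simp_all add: prestrict_hom peval_hom)
  also have "(\<lambda>i. peval x (prestrict U (pvar i))) = (\<lambda>i. x $ i)"
    using assms by (auto simp: prestrict_hom peval_hom)
  finally show ?thesis by (simp only: peval_eq_psubst)
qed

lemma continuous_on_peval [continuous_intros]: "continuous_on S (\<lambda>x. peval x p)"
  unfolding peval_def by (intro continuous_intros)

section \<open>Archimedean quadratic modules: the abstract Positivstellensatz\<close>

inductive_set sumsq :: "'a::comm_ring_1 set" where
  zero: "0 \<in> sumsq"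
| step: "s \<in> sumsq \<Longrightarrow> a ^ 2 + s \<in> sumsq"

lemma sumsq_add: "s \<in> sumsq \<Longrightarrow> t \<in> sumsq \<Longrightarrow> s + t \<in> sumsq"
  by (induction rule: sumsq.induct) (auto simp: add.assoc intro: sumsq.step)

lemma sumsq_square_mult: "s \<in> sumsq \<Longrightarrow> a ^ 2 * s \<in> sumsq"
proof (induction rule: sumsq.induct)
  case (step s b)
  then have "(a * b) ^ 2 + a ^ 2 * s \<in> sumsq" by (intro sumsq.step)
  then show ?case by (simp add: power_mult_distrib algebra_simps)
qed (auto intro: sumsq.zero)

definition quadratic_module :: "'a::comm_ring_1 set \<Rightarrow> bool" where
  "quadratic_module Q \<longleftrightarrow> 1 \<in> Q \<and> (\<forall>x\<in>Q. \<forall>y\<in>Q. x + y \<in> Q) \<and> (\<forall>a. \<forall>x\<in>Q. a ^ 2 * x \<in> Q)"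

lemma quadratic_module_one: "quadratic_module Q \<Longrightarrow> 1 \<in> Q"
  and quadratic_module_add: "quadratic_module Q \<Longrightarrow> x \<in> Q \<Longrightarrow> y \<in> Q \<Longrightarrow> x + y \<in> Q"
  and quadratic_module_square: "quadratic_module Q \<Longrightarrow> x \<in> Q \<Longrightarrow> a ^ 2 * x \<in> Q"
  by (auto simp: quadratic_module_def)

lemma quadratic_module_zero: "quadratic_module Q \<Longrightarrow> 0 \<in> Q"
  using quadratic_module_square[of Q 1 0] quadratic_module_one by fastforce

lemma quadratic_module_sumsq_mult:
  assumes "quadratic_module Q" "s \<in> sumsq" "x \<in> Q" shows "s * x \<in> Q"
  using assms(2)
proof (induction rule: sumsq.induct)
  case zero then show ?case using assms quadratic_module_zero by simp
next
  case (step s a)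
  then show ?case using assms by (simp add: distrib_right quadratic_module_add quadratic_module_square)
qed

text \<open>The quadratic module generated by \<open>Q\<close> and one further element.\<close>

lemma quadratic_module_extend:
  fixes a :: "'a::comm_ring_1"
  assumes Q: "quadratic_module Q"
  defines "Q' \<equiv> {q + s * a | q s. q \<in> Q \<and> s \<in> sumsq}"
  shows "quadratic_module Q'" "Q \<subseteq> Q'" "a \<in> Q'"
proof -
  show sub: "Q \<subseteq> Q'"
  proof
    fix q assume "q \<in> Q"
    then have "q = q + 0 * a \<and> q \<in> Q \<and> 0 \<in> sumsq" by (auto intro: sumsq.zero)
    then show "q \<in> Q'" unfolding Q'_def by blast
  qed
  have "a = 0 + (1 ^ 2 + 0) * a \<and> 0 \<in> Q \<and> 1 ^ 2 + 0 \<in> sumsq"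
    using quadratic_module_zero[OF Q] sumsq.step[OF sumsq.zero, of 1] by simp
  then show "a \<in> Q'" unfolding Q'_def by blast
  have "x + y \<in> Q'" if "x \<in> Q'" "y \<in> Q'" for x y
  proof -
    from that obtain q s q' s' where "x = q + s * a" "y = q' + s' * a"
      "q \<in> Q" "q' \<in> Q" "s \<in> sumsq" "s' \<in> sumsq" unfolding Q'_def by blast
    then have "x + y = (q + q') + (s + s') * a \<and> q + q' \<in> Q \<and> s + s' \<in> sumsq"
      using Q by (simp add: algebra_simps quadratic_module_add sumsq_add)
    then show ?thesis unfolding Q'_def by blast
  qed
  moreover have "b ^ 2 * x \<in> Q'" if "x \<in> Q'" for b x
  proof -
    from that obtain q s where "x = q + s * a" "q \<in> Q" "s \<in> sumsq" unfolding Q'_def by blast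
    then have "b ^ 2 * x = b ^ 2 * q + (b ^ 2 * s) * a \<and> b ^ 2 * q \<in> Q \<and> b ^ 2 * s \<in> sumsq"
      using quadratic_module_square[OF Q, of q b] sumsq_square_mult[of s b]
      by (simp add: distrib_left mult.assoc)
    then show ?thesis unfolding Q'_def by blast
  qed
  ultimately show "quadratic_module Q'"
    using sub quadratic_module_one[OF Q] unfolding quadratic_module_def by blast
qed

text \<open>Zorn's lemma. Maximality is used only through the relation \<open>- 1 = q + s * a\<close> that
  adjoining an element outside \<open>S\<close> produces.\<close>

lemma maximal_proper_quadratic_module:
  assumes Q: "quadratic_module Q" "- 1 \<notin> Q"
  obtains S where "Q \<subseteq> S" "quadratic_module S" "- 1 \<notin> S"
    "\<And>a. a \<notin> S \<Longrightarrow> \<exists>q\<in>S. \<exists>s\<in>sumsq. - 1 = q + s * a"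
proof -
  let ?A = "{S. Q \<subseteq> S \<and> quadratic_module S \<and> - 1 \<notin> S}"
  have "\<exists>M\<in>?A. \<forall>X\<in>?A. M \<subseteq> X \<longrightarrow> X = M"
  proof (rule subset_Zorn_nonempty)
    show "?A \<noteq> {}" using Q by blast
    fix C assume C: "C \<noteq> {}" "subset.chain ?A C"
    then have mem: "\<And>S. S \<in> C \<Longrightarrow> Q \<subseteq> S \<and> quadratic_module S \<and> - 1 \<notin> S"
      and lin: "\<And>S T. S \<in> C \<Longrightarrow> T \<in> C \<Longrightarrow> S \<subseteq> T \<or> T \<subseteq> S"
      by (auto simp: subset.chain_def)
    have "x + y \<in> \<Union>C" if xy: "x \<in> \<Union>C" "y \<in> \<Union>C" for x y
    proof -
      from xy obtain S T where "x \<in> S" "y \<in> T" "S \<in> C" "T \<in> C" by blast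
      with lin[of S T] obtain R where "R \<in> C" "x \<in> R" "y \<in> R" by blast
      then show ?thesis using mem[of R] quadratic_module_add by blast
    qed
    moreover have "a ^ 2 * x \<in> \<Union>C" if "x \<in> \<Union>C" for a x
      using that mem quadratic_module_square by blast
    moreover have "1 \<in> \<Union>C" using C(1) mem quadratic_module_one by blast
    ultimately have "quadratic_module (\<Union>C)" by (simp add: quadratic_module_def)
    then show "\<Union>C \<in> ?A" using C(1) mem by blast
  qed
  then obtain S where SA: "S \<in> ?A" and max: "\<forall>X\<in>?A. S \<subseteq> X \<longrightarrow> X = S"
    by (rule bexE)
  have S: "Q \<subseteq> S" "quadratic_module S" "- 1 \<notin> S" using SA by simp_all
  show ?thesis
  proof (rule that[OF S])
    fix a assume "a \<notin> S"
    let ?S' = "{q + s * a | q s. q \<in> S \<and> s \<in> sumsq}"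
    note ext = quadratic_module_extend[OF S(2), of a]
    have "?S' \<notin> ?A"
    proof
      assume "?S' \<in> ?A"
      from max[rule_format, OF this ext(2)] have "?S' = S" .
      have "a \<in> S" by (rule subst[OF \<open>?S' = S\<close>]) (rule ext(3))
      with \<open>a \<notin> S\<close> show False by contradiction
    qed
    moreover have "Q \<subseteq> ?S'" using S(1) ext(2) by (rule order_trans)
    ultimately have "- 1 \<in> ?S'" using ext(1)
      by (simp only: mem_Collect_eq[where P = "\<lambda>S. Q \<subseteq> S \<and> quadratic_module S \<and> - 1 \<notin> S"]
          simp_thms)
    then show "\<exists>q\<in>S. \<exists>s\<in>sumsq. - 1 = q + s * a" by blast
  qed
qed

context real_scalars
begin

lemma quadratic_module_const:
  assumes "quadratic_module Q" "0 \<le> r" shows "c r \<in> Q"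
proof -
  have "c r = c (sqrt r) ^ 2 * 1" using assms(2) by (simp add: power2_eq_square flip: c_mult)
  then show ?thesis using assms quadratic_module_square quadratic_module_one by metis
qed

lemma quadratic_module_scale:
  assumes "quadratic_module Q" "0 \<le> r" "x \<in> Q" shows "c r * x \<in> Q"
proof -
  have "c r = c (sqrt r) ^ 2" using assms(2) by (simp add: power2_eq_square flip: c_mult)
  then show ?thesis using assms quadratic_module_square by metis
qed

lemma quadratic_module_raise:
  assumes "quadratic_module Q" "c r - x \<in> Q" "r \<le> s" shows "c s - x \<in> Q"
proof -
  have "c (s - r) + (c r - x) \<in> Q"
    using assms by (intro quadratic_module_add quadratic_module_const) auto
  then show ?thesis by (simp add: c_diff)
qed

definition archimedean :: "'a set \<Rightarrow> bool" where
  "archimedean Q \<longleftrightarrow> (\<forall>a. \<exists>r. c r - a \<in> Q)"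

text \<open>Quadratic modules are not closed under products, so \<open>(r + a) * (r - a)\<close> is not available directly.
  But \<open>(r + a)\<^sup>2 * (r - a) + (r - a)\<^sup>2 * (r + a) = 2 * r * (r\<^sup>2 - a\<^sup>2)\<close> is in the module.\<close>

lemma square_le_bound_square:
  assumes Q: "quadratic_module Q" and r: "0 < r" and "c r + a \<in> Q" "c r - a \<in> Q"
  shows "c (r ^ 2) - a ^ 2 \<in> Q"
proof -
  have "(c r + a) ^ 2 * (c r - a) + (c r - a) ^ 2 * (c r + a) \<in> Q"
    by (intro quadratic_module_add[OF Q] quadratic_module_square[OF Q] assms)
  moreover have "(c r + a) ^ 2 * (c r - a) + (c r - a) ^ 2 * (c r + a) = (c r + c r) * (c r ^ 2 - a ^ 2)"
    by (simp add: power2_eq_square algebra_simps)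
  ultimately have "(c r + c r) * (c r ^ 2 - a ^ 2) \<in> Q" by simp
  then have "c (1 / (r + r)) * ((c r + c r) * (c r ^ 2 - a ^ 2)) \<in> Q"
    using Q r by (intro quadratic_module_scale) auto
  moreover have "c (1 / (r + r)) * (c r + c r) = 1"
  proof -
    have "c (1 / (r + r)) * c (r + r) = 1"
      unfolding c_mult[symmetric] using r by simp
    then show ?thesis by (simp only: c_add)
  qed
  ultimately show ?thesis
    by (simp add: power2_eq_square c_mult flip: mult.assoc)
qed

text \<open>A positive sum-of-squares multiplier can be removed. The element \<open>a + r\<close> is in \<open>M\<close> for some
  \<open>r\<close>, and the certificate \<open>s * a - 1 \<in> M\<close> allows \<open>r\<close> to be lowered by a fixed amount
  \<open>1 / k\<^sup>2\<close> as long as it is nonnegative, so after finitely many rounds \<open>r \<le> 0\<close>.\<close>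

lemma archimedean_divide:
  assumes M: "quadratic_module M" and arch: "archimedean M"
    and s: "s \<in> sumsq" and sa: "s * a - 1 \<in> M"
  shows "a \<in> M"
proof -
  obtain r1 r2 r0 where r1: "c r1 - s ^ 2 * a \<in> M" and r2: "c r2 - s \<in> M" and r0: "c r0 - (- a) \<in> M"
    using arch unfolding archimedean_def by blast
  define k where "k = max 1 (max (r1 + 1) r2)"
  have k: "k \<ge> 1" "2 * k - 1 \<ge> r1" "2 * k \<ge> r2"
  proof -
    have "1 \<le> k" "r1 + 1 \<le> k" "r2 \<le> k" by (simp_all add: k_def)
    then show "k \<ge> 1" "2 * k - 1 \<ge> r1" "2 * k \<ge> r2" by linarith+
  qed
  define \<delta> where "\<delta> = 1 / k ^ 2"
  have k1: "c (2 * k - 1) - s ^ 2 * a \<in> M" using quadratic_module_raise[OF M r1] k by blast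
  have "c (2 * k) - s \<in> M" using quadratic_module_raise[OF M r2] k by blast
  then have k2: "s * (c (2 * k) - s) \<in> M" by (rule quadratic_module_sumsq_mult[OF M s])
  have lower: "a + c (r - \<delta>) \<in> M" if "0 \<le> r" "a + c r \<in> M" for r
  proof -
    \<comment> \<open>Each summand is in \<open>M\<close>, and the terms in \<open>s\<close> cancel, leaving \<open>k\<^sup>2 * (a + r) - 1\<close>.\<close>
    have "(c k - s) ^ 2 * (a + c r) + c (2 * k) * (s * a - 1) + c r * (s * (c (2 * k) - s))
        + (c (2 * k - 1) - s ^ 2 * a) \<in> M"
    proof (intro quadratic_module_add[OF M])
      show "(c k - s) ^ 2 * (a + c r) \<in> M" by (rule quadratic_module_square[OF M that(2)])
      show "c (2 * k) * (s * a - 1) \<in> M" using k(1) sa by (intro quadratic_module_scale[OF M]) auto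
      show "c r * (s * (c (2 * k) - s)) \<in> M" using that(1) k2 by (rule quadratic_module_scale[OF M])
    qed (rule k1)
    also have "(c k - s) ^ 2 * (a + c r) + c (2 * k) * (s * a - 1) + c r * (s * (c (2 * k) - s))
        + (c (2 * k - 1) - s ^ 2 * a) = c k ^ 2 * (a + c r) - 1"
    proof -
      have "c (2 * k) = c k + c k" by (simp flip: c_add)
      then show ?thesis by (simp add: c_diff power2_eq_square algebra_simps)
    qed
    finally have "c (1 / k) ^ 2 * (c k ^ 2 * (a + c r) - 1) \<in> M"
      by (rule quadratic_module_square[OF M])
    moreover have "c (1 / k) * c k = 1"
      using k by (simp flip: c_mult)
    then have "c (1 / k) ^ 2 * c k ^ 2 = 1"
      by (simp flip: power_mult_distrib)
    moreover have "c (1 / k) ^ 2 = c \<delta>"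
      by (simp add: \<delta>_def power2_eq_square flip: c_mult)
    ultimately have "a + c r - c \<delta> \<in> M"
      by (simp add: right_diff_distrib flip: mult.assoc)
    then show ?thesis by (simp add: c_diff algebra_simps)
  qed
  have \<delta>: "\<delta> > 0" using k by (simp add: \<delta>_def)
  have nonpos: "a \<in> M" if "r \<le> 0" "a + c r \<in> M" for r
  proof -
    have "(a + c r) + c (- r) \<in> M"
      using that by (intro quadratic_module_add[OF M that(2)] quadratic_module_const[OF M]) simp
    then show ?thesis by (simp add: c_minus)
  qed
  have descend: "a \<in> M" if "r \<le> real n * \<delta>" "a + c r \<in> M" for r n
    using that
  proof (induction n arbitrary: r)
    case 0 then show ?case using nonpos by simp
  next
    case (Suc n)
    show ?case
    proof (cases "r \<le> 0")
      case True then show ?thesis using nonpos Suc.prems by blast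
    next
      case False
      then have "a + c (r - \<delta>) \<in> M" using lower Suc.prems by simp
      moreover have "r - \<delta> \<le> real n * \<delta>" using Suc.prems by (simp add: algebra_simps)
      ultimately show ?thesis using Suc.IH by blast
    qed
  qed
  obtain n where "r0 < real n * \<delta>" using \<delta> reals_Archimedean3 by blast
  with descend[of r0 n] r0 show ?thesis by (simp add: add.commute)
qed

text \<open>For each \<open>a\<close> the reals \<open>r\<close> with \<open>a - r \<in> S\<close> form a lower cut, bounded because \<open>S\<close> is Archimedean and
  proper, and totality puts \<open>r - a\<close> in \<open>S\<close> above the cut. The cut is the value of the
  character. Multiplicativity reduces to squares by polarisation, and then, after subtracting
  its value from \<open>a\<close>, to \<open>square_le_bound_square\<close>.\<close>

lemma character_of_total_module:
  assumes S: "quadratic_module S" and arch: "archimedean S" and proper: "- 1 \<notin> S"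
    and total: "\<And>a. a \<in> S \<or> - a \<in> S"
  obtains \<alpha> :: "'a \<Rightarrow> real" where "\<And>r. \<alpha> (c r) = r" "\<And>a b. \<alpha> (a + b) = \<alpha> a + \<alpha> b"
    "\<And>a b. \<alpha> (a * b) = \<alpha> a * \<alpha> b" "\<And>a. a \<in> S \<Longrightarrow> 0 \<le> \<alpha> a"
proof -
  note add = quadratic_module_add[OF S] and const = quadratic_module_const[OF S]
    and scale = quadratic_module_scale[OF S] and square = quadratic_module_square[OF S]
  have nonneg: "0 \<le> r" if "c r \<in> S" for r
  proof (rule ccontr)
    assume "\<not> 0 \<le> r"
    then have "c (1 / - r) * c r \<in> S" using that by (intro scale) auto
    moreover have "c (1 / - r) * c r = - 1"
      unfolding c_mult[symmetric] using \<open>\<not> 0 \<le> r\<close> by (simp add: c_minus)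
    ultimately show False using proper by simp
  qed
  define \<alpha> where "\<alpha> a = Sup {r. a - c r \<in> S}" for a
  have ne: "{r. a - c r \<in> S} \<noteq> {}" for a
  proof -
    obtain r where "c r - (- a) \<in> S" using arch unfolding archimedean_def by blast
    then have "a - c (- r) \<in> S" by (simp add: c_minus add.commute)
    then show ?thesis by blast
  qed
  have upper: "s \<le> r" if "c r - a \<in> S" "a - c s \<in> S" for a r s
    using add[OF that] nonneg[of "r - s"] by (simp add: c_diff)
  have bdd: "bdd_above {r. a - c r \<in> S}" for a
  proof -
    obtain r where "c r - a \<in> S" using arch unfolding archimedean_def by blast
    then show ?thesis using upper by (intro bdd_aboveI[of _ r]) auto
  qed
  have below: "a - c r \<in> S" if "r < \<alpha> a" for a r
  proof -
    from that obtain s where "a - c s \<in> S" "r < s"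
      using less_cSup_iff[OF ne[of a] bdd[of a], of r] by (auto simp: \<alpha>_def)
    then have "(a - c s) + c (s - r) \<in> S" by (intro add const) auto
    then show ?thesis by (simp add: c_diff)
  qed
  have above: "c r - a \<in> S" if "\<alpha> a < r" for a r
  proof -
    have "a - c r \<notin> S"
    proof
      assume "a - c r \<in> S"
      then have "r \<le> \<alpha> a" unfolding \<alpha>_def using bdd by (intro cSup_upper) auto
      with that show False by simp
    qed
    then show ?thesis using total[of "a - c r"] by simp
  qed
  have eqI: "\<alpha> a = v" if "\<And>\<epsilon>. \<epsilon> > 0 \<Longrightarrow> a - c (v - \<epsilon>) \<in> S" "\<And>\<epsilon>. \<epsilon> > 0 \<Longrightarrow> c (v + \<epsilon>) - a \<in> S" for a v
  proof (rule antisym)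
    show "v \<le> \<alpha> a"
    proof (rule field_le_epsilon)
      fix e :: real assume "e > 0"
      then have "v - e \<le> \<alpha> a" unfolding \<alpha>_def using bdd that(1) by (intro cSup_upper) auto
      then show "v \<le> \<alpha> a + e" by simp
    qed
    show "\<alpha> a \<le> v"
    proof (rule field_le_epsilon)
      fix e :: real assume "e > 0"
      then show "\<alpha> a \<le> v + e" 
        unfolding \<alpha>_def using ne upper[OF that(2)] by (intro cSup_least) auto
    qed
  qed
  have \<alpha>c: "\<alpha> (c r) = r" for r
    by (rule eqI) (use const in \<open>simp_all flip: c_diff\<close>)
  have \<alpha>add: "\<alpha> (a + b) = \<alpha> a + \<alpha> b" for a b
  proof (rule eqI)
    fix \<epsilon> :: real assume "\<epsilon> > 0"
    then have "(a - c (\<alpha> a - \<epsilon> / 2)) + (b - c (\<alpha> b - \<epsilon> / 2)) \<in> S" by (intro add below) auto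
    moreover have "c (\<alpha> a + \<alpha> b - \<epsilon>) = c (\<alpha> a - \<epsilon> / 2) + c (\<alpha> b - \<epsilon> / 2)" by (simp flip: c_add)
    ultimately show "a + b - c (\<alpha> a + \<alpha> b - \<epsilon>) \<in> S" by (simp add: algebra_simps)
    have "(c (\<alpha> a + \<epsilon> / 2) - a) + (c (\<alpha> b + \<epsilon> / 2) - b) \<in> S" using \<open>\<epsilon> > 0\<close> by (intro add above) auto
    moreover have "c (\<alpha> a + \<alpha> b + \<epsilon>) = c (\<alpha> a + \<epsilon> / 2) + c (\<alpha> b + \<epsilon> / 2)" by (simp add: ac_simps flip: c_add)
    ultimately show "c (\<alpha> a + \<alpha> b + \<epsilon>) - (a + b) \<in> S" by (simp add: algebra_simps)
  qed
  have \<alpha>sq: "\<alpha> (a ^ 2) = \<alpha> a ^ 2" for a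
  proof -
    define v where "v = \<alpha> a"
    define b where "b = a - c v"
    have small: "c \<delta> + b \<in> S" "c \<delta> - b \<in> S" if "\<delta> > 0" for \<delta>
      using below[of "v - \<delta>" a] above[of a "v + \<delta>"] that
      by (simp_all add: v_def b_def c_diff c_add algebra_simps)
    \<comment> \<open>The centred element \<open>b\<close> is infinitesimal with respect to \<open>S\<close>, and so are its multiples and its square.\<close>
    have lin: "c \<delta> + c k * b \<in> S" if "\<delta> > 0" for \<delta> k
    proof (cases k "0::real" rule: linorder_cases)
      case equal then show ?thesis using const[of \<delta>] that by simp
    next
      case greater
      then have "c k * (c (\<delta> / k) + b) \<in> S" using that by (intro scale small) auto
      moreover have "c k * c (\<delta> / k) = c \<delta>" using greater by (simp flip: c_mult)
      ultimately show ?thesis by (simp add: distrib_left)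
    next
      case less
      then have "c (- k) * (c (\<delta> / - k) - b) \<in> S"
        using that by (intro scale small) (auto simp: divide_pos_neg)
      moreover have "c (- k) * c (\<delta> / - k) = c \<delta>"
        unfolding c_mult[symmetric] using less by simp
      ultimately show ?thesis by (simp add: right_diff_distrib c_minus)
    qed
    have bsq: "c \<epsilon> - b ^ 2 \<in> S" if "\<epsilon> > 0" for \<epsilon>
      using square_le_bound_square[OF S, of "sqrt \<epsilon>" b] small[of "sqrt \<epsilon>"] that by simp
    have vvm: "c (- (v + v)) = - c v + - c v"
      by (simp only: c_minus c_add minus_add_distrib)
    have "\<alpha> (a ^ 2) = v ^ 2"
    proof (rule eqI)
      fix \<epsilon> :: real assume e: "\<epsilon> > 0"
      have "b ^ 2 * 1 + (c \<epsilon> + (c v + c v) * b) \<in> S"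
        unfolding c_add[symmetric] using e by (intro add square lin quadratic_module_one[OF S])
      then show "a ^ 2 - c (v ^ 2 - \<epsilon>) \<in> S"
        by (simp add: b_def c_diff c_mult power2_eq_square algebra_simps)
      have "(c (\<epsilon> / 2) - b ^ 2) + (c (\<epsilon> / 2) + (- c v + - c v) * b) \<in> S"
        unfolding vvm[symmetric] using e by (intro add bsq lin) auto
      moreover have "c \<epsilon> = c (\<epsilon> / 2) + c (\<epsilon> / 2)" by (simp flip: c_add)
      ultimately show "c (v ^ 2 + \<epsilon>) - a ^ 2 \<in> S"
        by (simp add: b_def c_add c_mult power2_eq_square algebra_simps)
    qed
    then show ?thesis by (simp add: v_def)
  qed
  have \<alpha>mult: "\<alpha> (a * b) = \<alpha> a * \<alpha> b" for a b
  proof -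
    have "\<alpha> ((a + b) ^ 2) = \<alpha> (a ^ 2 + b ^ 2 + a * b + a * b)"
      by (rule arg_cong[of _ _ \<alpha>]) (simp add: power2_eq_square algebra_simps)
    then have "(\<alpha> a + \<alpha> b) ^ 2 = \<alpha> a ^ 2 + \<alpha> b ^ 2 + \<alpha> (a * b) + \<alpha> (a * b)"
      by (simp only: \<alpha>add \<alpha>sq)
    then show ?thesis by (simp add: power2_eq_square algebra_simps)
  qed
  have "0 \<le> \<alpha> a" if "a \<in> S" for a
    unfolding \<alpha>_def using bdd that by (intro cSup_upper) auto
  with \<alpha>c \<alpha>add \<alpha>mult that show ?thesis by blast
qed

text \<open>Jacobi's representation theorem: positivity under all characters that are nonnegative on \<open>Q\<close>
  implies membership. Maximality and \<open>archimedean_divide\<close>, applied to \<open>- a\<close>, show that the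
  maximal module above \<open>Q\<close> and \<open>- h\<close> contains \<open>a\<close> or \<open>- a\<close> for every \<open>a\<close>.\<close>

theorem archimedean_positivstellensatz:
  assumes Q: "quadratic_module Q" and arch: "archimedean Q"
    and pos: "\<And>\<alpha> :: 'a \<Rightarrow> real. (\<And>r. \<alpha> (c r) = r) \<Longrightarrow> (\<And>a b. \<alpha> (a + b) = \<alpha> a + \<alpha> b) \<Longrightarrow>
       (\<And>a b. \<alpha> (a * b) = \<alpha> a * \<alpha> b) \<Longrightarrow> (\<And>q. q \<in> Q \<Longrightarrow> 0 \<le> \<alpha> q) \<Longrightarrow> 0 < \<alpha> h"
  shows "h \<in> Q"
proof -
  let ?Q' = "{q + s * (- h) | q s. q \<in> Q \<and> s \<in> sumsq}"
  note ext = quadratic_module_extend[OF Q, of "- h"]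
  have "- 1 \<in> ?Q'"
  proof (rule ccontr)
    assume "- 1 \<notin> ?Q'"
    obtain S where S: "?Q' \<subseteq> S" "quadratic_module S" "- 1 \<notin> S"
      and max: "\<And>a. a \<notin> S \<Longrightarrow> \<exists>q\<in>S. \<exists>s\<in>sumsq. - 1 = q + s * a"
      using maximal_proper_quadratic_module[OF ext(1) \<open>- 1 \<notin> ?Q'\<close>] by blast
    have archS: "archimedean S" using arch ext(2) S(1) unfolding archimedean_def by blast
    have total: "a \<in> S \<or> - a \<in> S" for a
    proof (cases "a \<in> S")
      case False
      then obtain q s where qs: "q \<in> S" "s \<in> sumsq" "- 1 = q + s * a" using max by blast
      have "s * (- a) - 1 = s * (- a) + (q + s * a)" unfolding qs(3)[symmetric] by simp
      then have "s * (- a) - 1 \<in> S" using qs(1) by simp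
      then show ?thesis using archimedean_divide[OF S(2) archS qs(2), of "- a"] by simp
    qed simp
    obtain \<alpha> :: "'a \<Rightarrow> real" where \<alpha>: "\<And>r. \<alpha> (c r) = r" "\<And>a b. \<alpha> (a + b) = \<alpha> a + \<alpha> b"
      "\<And>a b. \<alpha> (a * b) = \<alpha> a * \<alpha> b" "\<And>a. a \<in> S \<Longrightarrow> 0 \<le> \<alpha> a"
      using character_of_total_module[OF S(2) archS S(3) total] by blast
    have "Q \<subseteq> S" using S(1) ext(2) by (rule order_trans[rotated])
    then have "0 < \<alpha> h" using \<alpha> by (intro pos) blast+
    moreover have "0 \<le> \<alpha> (- h)" using \<alpha>(4) S(1) ext(3) by blast
    moreover have "\<alpha> (- h) + \<alpha> h = 0" using \<alpha>(1)[of 0] \<alpha>(2)[of "- h" h] by simp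
    ultimately show False by simp
  qed
  then obtain q s where qs: "q \<in> Q" "s \<in> sumsq" "- 1 = q + s * (- h)" by blast
  have "s * h - 1 = s * h + (q + s * (- h))" unfolding qs(3)[symmetric] by simp
  then have "s * h - 1 \<in> Q" using qs(1) by simp
  then show ?thesis by (rule archimedean_divide[OF Q arch qs(2)])
qed

end

section \<open>Putinar's theorem for real polynomials\<close>

text \<open>The elements bounded on both sides by constants modulo \<open>Q\<close> form a subring, by polarisation and
  \<open>square_le_bound_square\<close>; it contains the variables, since
  \<open>R + 1 \<plusminus> 2 * x = (R - x\<^sup>2) + (x \<plusminus> 1)\<^sup>2\<close>. So bounding the single
  polynomial \<open>\<Sum>i. (pvar i)\<^sup>2\<close> bounds every polynomial.\<close>

lemma archimedean_rpoly:
  fixes Q :: "'n::finite rpoly set"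
  assumes Q: "quadratic_module Q" and R: "pconst R - (\<Sum>i\<in>UNIV. pvar i ^ 2) \<in> Q"
  shows "pconst.archimedean Q"
proof -
  define B where "B = {p :: 'n rpoly. \<exists>r>0. pconst r + p \<in> Q \<and> pconst r - p \<in> Q}"
  note add = quadratic_module_add[OF Q] and const = pconst.quadratic_module_const[OF Q]
  have BI: "p \<in> B" if "r > 0" "pconst r + p \<in> Q" "pconst r - p \<in> Q" for r p
    unfolding B_def using that by blast
  have BE: "\<exists>r>0. pconst r + p \<in> Q \<and> pconst r - p \<in> Q" if "p \<in> B" for p
    using that unfolding B_def by blast
  have Badd: "p + q \<in> B" if pq: "p \<in> B" "q \<in> B" for p q
  proof -
    obtain r where r: "r > 0" "pconst r + p \<in> Q" "pconst r - p \<in> Q" using BE[OF pq(1)] by blast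
    obtain s where s: "s > 0" "pconst s + q \<in> Q" "pconst s - q \<in> Q" using BE[OF pq(2)] by blast
    show ?thesis
    proof (rule BI[of "r + s"])
      show "pconst (r + s) + (p + q) \<in> Q"
        using add[OF r(2) s(2)] by (simp add: pconst.c_add ac_simps)
      show "pconst (r + s) - (p + q) \<in> Q"
        using add[OF r(3) s(3)] by (simp add: pconst.c_add algebra_simps)
    qed (use r s in simp)
  qed
  have Bneg: "- p \<in> B" if p: "p \<in> B" for p
  proof -
    obtain r where r: "r > 0" "pconst r + p \<in> Q" "pconst r - p \<in> Q" using BE[OF p] by blast
    then show ?thesis by (intro BI[of r]) simp_all
  qed
  have Bscale: "pconst k * p \<in> B" if p: "p \<in> B" and k: "0 < k" for k p
  proof -
    obtain r where r: "r > 0" "pconst r + p \<in> Q" "pconst r - p \<in> Q" using BE[OF p] by blast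
    note scale = pconst.quadratic_module_scale[OF Q less_imp_le[OF k]]
    show ?thesis
    proof (rule BI[of "k * r"])
      show "pconst (k * r) + pconst k * p \<in> Q"
        using scale[OF r(2)] by (simp only: pconst.c_mult distrib_left)
      show "pconst (k * r) - pconst k * p \<in> Q"
        using scale[OF r(3)] by (simp only: pconst.c_mult right_diff_distrib)
    qed (use r k in simp)
  qed
  have Bsq: "p ^ 2 \<in> B" if p: "p \<in> B" for p
  proof -
    obtain r where r: "r > 0" "pconst r + p \<in> Q" "pconst r - p \<in> Q" using BE[OF p] by blast
    show ?thesis
    proof (rule BI[of "r ^ 2"])
      show "pconst (r ^ 2) - p ^ 2 \<in> Q" by (rule pconst.square_le_bound_square[OF Q r])
      show "pconst (r ^ 2) + p ^ 2 \<in> Q"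
        using add[OF const[of "r ^ 2"] quadratic_module_square[OF Q quadratic_module_one[OF Q], of p]]
        by simp
    qed (use r in simp)
  qed
  have Bmult: "p * q \<in> B" if "p \<in> B" "q \<in> B" for p q
  proof -
    have "pconst (1 / 2) * ((p + q) ^ 2 + (- (p ^ 2) + - (q ^ 2))) \<in> B"
      using that by (intro Bscale Badd Bsq Bneg) auto
    moreover have "(p + q) ^ 2 + (- (p ^ 2) + - (q ^ 2)) = p * q + p * q"
      by (simp add: power2_eq_square algebra_simps)
    moreover have "pconst (1 / 2) * (p * q + p * q) = pconst (1 / 2 + 1 / 2) * (p * q)"
      by (simp only: pconst.c_add distrib_left distrib_right)
    ultimately show ?thesis by simp
  qed
  have Bconst: "pconst r \<in> B" for r
  proof -
    have "pconst (\<bar>r\<bar> + 1 + r) \<in> Q" "pconst (\<bar>r\<bar> + 1 - r) \<in> Q" by (intro const; simp)+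
    then have "pconst (\<bar>r\<bar> + 1) + pconst r \<in> Q" "pconst (\<bar>r\<bar> + 1) - pconst r \<in> Q"
      by (simp_all only: pconst.c_add pconst.c_diff)
    then show ?thesis by (intro BI[of "\<bar>r\<bar> + 1"]) simp_all
  qed
  have Bvar: "pvar i \<in> B" for i
  proof -
    have sq: "a ^ 2 \<in> Q" for a
      using quadratic_module_square[OF Q quadratic_module_one[OF Q], of a] by simp
    have "(\<Sum>j\<in>A. pvar j ^ 2) \<in> Q" if "finite A" for A :: "'n set"
      using that by (induction A) (auto intro: sq add quadratic_module_zero[OF Q])
    then have "(pconst R - (\<Sum>i\<in>UNIV. pvar i ^ 2)) + (\<Sum>j\<in>UNIV - {i}. pvar j ^ 2) \<in> Q"
      by (intro add R) auto
    then have Ri: "pconst R - pvar i ^ 2 \<in> Q"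
      by (simp add: sum.remove[of UNIV i])
    have "pconst (\<bar>R\<bar> - R) + (pconst R - pvar i ^ 2) + (pvar i + 1) ^ 2 \<in> Q"
         "pconst (\<bar>R\<bar> - R) + (pconst R - pvar i ^ 2) + (pvar i - 1) ^ 2 \<in> Q"
      by (intro add const sq Ri; simp)+
    then have "pconst (\<bar>R\<bar> + 1) + (pvar i + pvar i) \<in> Q" "pconst (\<bar>R\<bar> + 1) - (pvar i + pvar i) \<in> Q"
      by (simp_all add: pconst.c_diff pconst.c_add power2_eq_square algebra_simps)
    then have "pvar i + pvar i \<in> B"
      by (intro BI[of "\<bar>R\<bar> + 1"]) simp_all
    then have "pconst (1 / 2) * (pvar i + pvar i) \<in> B" by (intro Bscale) auto
    moreover have "pconst (1 / 2) * (pvar i + pvar i) = pconst (1 / 2 + 1 / 2) * pvar i"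
      by (simp only: pconst.c_add distrib_left distrib_right)
    ultimately show ?thesis by simp
  qed
  have Bone: "1 \<in> B" and Bzero: "0 \<in> B" using Bconst[of 1] Bconst[of 0] by simp_all
  have Bpow: "q ^ k \<in> B" if "q \<in> B" for q k
    using that by (induction k) (auto intro: Bmult Bone)
  have Bprod: "prod F A \<in> B" if "\<And>x. x \<in> A \<Longrightarrow> F x \<in> B" for F :: "'n \<Rightarrow> 'n rpoly" and A
    using that by (induction A rule: infinite_finite_induct) (auto intro: Bmult Bone)
  have Bsum: "sum F A \<in> B" if "\<And>x. x \<in> A \<Longrightarrow> F x \<in> B" for F :: "('n \<Rightarrow>\<^sub>0 nat) \<Rightarrow> 'n rpoly" and A
    using that by (induction A rule: infinite_finite_induct) (auto intro: Badd Bzero)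
  have "p \<in> B" for p
  proof -
    have "pconst.psubst pvar p \<in> B"
      unfolding pconst.psubst_def monom_eval_def
      by (intro Bsum Bmult Bprod Bpow Bconst Bvar)
    then show ?thesis by (simp add: psubst_pvar_ident)
  qed
  then show ?thesis unfolding pconst.archimedean_def B_def by blast
qed

text \<open>A character of the polynomial ring is evaluation at the point of its values on the
  variables.\<close>

theorem putinar:
  fixes Q :: "'n::finite rpoly set"
  assumes Q: "quadratic_module Q" and R: "pconst R - (\<Sum>i\<in>UNIV. pvar i ^ 2) \<in> Q"
    and pos: "\<And>x. (\<And>q. q \<in> Q \<Longrightarrow> 0 \<le> peval x q) \<Longrightarrow> 0 < peval x h"
  shows "h \<in> Q"
proof (rule pconst.archimedean_positivstellensatz[OF Q archimedean_rpoly[OF Q R]])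
  fix \<alpha> :: "'n rpoly \<Rightarrow> real"
  assume \<alpha>: "\<And>r. \<alpha> (pconst r) = r" "\<And>a b. \<alpha> (a + b) = \<alpha> a + \<alpha> b"
    "\<And>a b. \<alpha> (a * b) = \<alpha> a * \<alpha> b" "\<And>q. q \<in> Q \<Longrightarrow> 0 \<le> \<alpha> q"
  have "\<alpha> p = peval (\<chi> i. \<alpha> (pvar i)) p" for p
  proof -
    have "\<alpha> p = ident.psubst (\<lambda>i. \<alpha> (pvar i)) p"
      by (rule ident.alg_hom_eq_psubst) (simp_all only: \<alpha>(1-3) id_apply)
    also have "(\<lambda>i. \<alpha> (pvar i)) = (\<lambda>i. (\<chi> i. \<alpha> (pvar i)) $ i)" by simp
    finally show ?thesis by (simp only: peval_eq_psubst)
  qed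
  then show "0 < \<alpha> h" using pos \<alpha>(4) by metis
qed

lemma sos_zero: "0 \<in> sos U"
  unfolding sos_def by (auto intro!: exI[of _ "[]"])

lemma sos_square: "q \<in> polys U \<Longrightarrow> q ^ 2 \<in> sos U"
  unfolding sos_def by (auto intro!: exI[of _ "[q]"])

lemma sos_add: "s \<in> sos U \<Longrightarrow> t \<in> sos U \<Longrightarrow> s + t \<in> sos U"
proof -
  assume "s \<in> sos U" "t \<in> sos U"
  then obtain ps qs where "s = (\<Sum>q\<leftarrow>ps. q ^ 2)" "set ps \<subseteq> polys U" "t = (\<Sum>q\<leftarrow>qs. q ^ 2)" "set qs \<subseteq> polys U"
    unfolding sos_def by blast
  then have "s + t = (\<Sum>q\<leftarrow>ps @ qs. q ^ 2) \<and> set (ps @ qs) \<subseteq> polys U" by simp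
  then show ?thesis unfolding sos_def by blast
qed

lemma polys_mult: "p \<in> polys U \<Longrightarrow> q \<in> polys U \<Longrightarrow> p * q \<in> polys U"
  by (simp add: polys_iff_prestrict prestrict_hom)

lemma sos_square_mult:
  assumes "a \<in> polys U" "s \<in> sos U" shows "a ^ 2 * s \<in> sos U"
proof -
  from assms(2) obtain qs where s: "s = (\<Sum>q\<leftarrow>qs. q ^ 2)" "set qs \<subseteq> polys U"
    unfolding sos_def by blast
  have "a ^ 2 * (\<Sum>q\<leftarrow>qs. q ^ 2) = (\<Sum>q\<leftarrow>map ((*) a) qs. q ^ 2)"
    by (induction qs) (simp_all add: distrib_left power_mult_distrib)
  moreover have "set (map ((*) a) qs) \<subseteq> polys U"
    using s(2) assms(1) by (auto intro: polys_mult)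
  ultimately show ?thesis unfolding sos_def s(1) by blast
qed

lemma sos_prestrict: "s \<in> sos W \<Longrightarrow> prestrict U s \<in> sos U"
proof -
  assume "s \<in> sos W"
  then obtain qs where s: "s = (\<Sum>q\<leftarrow>qs. q ^ 2)" unfolding sos_def by blast
  have "prestrict U s = (\<Sum>q\<leftarrow>map (prestrict U) qs. q ^ 2)"
    unfolding s by (simp add: prestrict_sum_list prestrict_hom o_def)
  moreover have "set (map (prestrict U) qs) \<subseteq> polys U" by (auto simp: prestrict_in_polys)
  ultimately show ?thesis unfolding sos_def by blast
qed

lemma peval_sos_nonneg: "s \<in> sos U \<Longrightarrow> 0 \<le> peval x s"
  unfolding sos_def by (auto simp: peval_sum_list peval_hom intro!: sum_list_nonneg)

lemma quad_module_prestrict: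
  assumes "q \<in> quad_module W m g"
  shows "prestrict U q \<in> quad_module U m (\<lambda>j. prestrict U (g j))"
proof -
  from assms obtain \<sigma> where q: "q = \<sigma> 0 + (\<Sum>j=1..m. \<sigma> j * g j)" and \<sigma>: "\<forall>j\<in>{0..m}. \<sigma> j \<in> sos W"
    unfolding quad_module_def by blast
  have "prestrict U q = prestrict U (\<sigma> 0) + (\<Sum>j=1..m. prestrict U (\<sigma> j) * prestrict U (g j))"
    unfolding q by (simp add: prestrict_hom)
  moreover have "\<forall>j\<in>{0..m}. prestrict U (\<sigma> j) \<in> sos U" using \<sigma> sos_prestrict by blast
  ultimately show ?thesis
    unfolding quad_module_def mem_Collect_eq by (intro exI[of _ "\<lambda>j. prestrict U (\<sigma> j)"] conjI)
qed

lemma trunc_quad_module_prestrict: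
  assumes "q \<in> trunc_quad_module W m g d"
  shows "prestrict U q \<in> trunc_quad_module U m (\<lambda>j. prestrict U (g j)) d"
proof -
  from assms obtain \<sigma> where q: "q = \<sigma> 0 + (\<Sum>j=1..m. \<sigma> j * g j)" and \<sigma>: "\<forall>j\<in>{0..m}. \<sigma> j \<in> sos W"
    and deg: "pdeg (\<sigma> 0) \<le> d" "\<forall>j\<in>{1..m}. pdeg (\<sigma> j * g j) \<le> d"
    unfolding trunc_quad_module_def by blast
  have "prestrict U q = prestrict U (\<sigma> 0) + (\<Sum>j=1..m. prestrict U (\<sigma> j) * prestrict U (g j))"
    unfolding q by (simp add: prestrict_hom)
  moreover have "\<forall>j\<in>{0..m}. prestrict U (\<sigma> j) \<in> sos U" using \<sigma> sos_prestrict by blast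
  moreover have "pdeg (prestrict U (\<sigma> 0)) \<le> d" using deg(1) by (rule pdeg_prestrict)
  moreover have "\<forall>j\<in>{1..m}. pdeg (prestrict U (\<sigma> j) * prestrict U (g j)) \<le> d"
    using deg(2) pdeg_prestrict[of "\<sigma> _ * g _" d U] by (simp add: prestrict_hom)
  ultimately show ?thesis
    unfolding trunc_quad_module_def mem_Collect_eq
    by (intro exI[of _ "\<lambda>j. prestrict U (\<sigma> j)"] conjI)
qed

lemma eventually_trunc_quad_module:
  assumes "q \<in> quad_module U m g"
  shows "\<forall>\<^sub>F t in sequentially. q \<in> trunc_quad_module U m g (2 * t)"
proof -
  from assms obtain \<sigma> where q: "q = \<sigma> 0 + (\<Sum>j=1..m. \<sigma> j * g j)" and \<sigma>: "\<forall>j\<in>{0..m}. \<sigma> j \<in> sos U"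
    unfolding quad_module_def by blast
  define D where "D = pdeg (\<sigma> 0) + (\<Sum>j\<in>{1..m}. pdeg (\<sigma> j * g j))"
  have "q \<in> trunc_quad_module U m g (2 * t)" if "D \<le> t" for t
  proof -
    have "pdeg (\<sigma> j * g j) \<le> (\<Sum>j\<in>{1..m}. pdeg (\<sigma> j * g j))" if "j \<in> {1..m}" for j
      using that by (intro member_le_sum) auto
    then have "\<forall>j\<in>{1..m}. pdeg (\<sigma> j * g j) \<le> 2 * t"
      using that unfolding D_def by fastforce
    moreover have "pdeg (\<sigma> 0) \<le> 2 * t" using that unfolding D_def by simp
    ultimately show ?thesis
      unfolding trunc_quad_module_def mem_Collect_eq using q \<sigma> by (intro exI[of _ \<sigma>] conjI)
  qed
  then show ?thesis unfolding eventually_sequentially by blast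
qed

lemma peval_quad_module_nonneg:
  assumes "q \<in> quad_module U m g" "\<forall>j\<in>{1..m}. 0 \<le> peval x (g j)"
  shows "0 \<le> peval x q"
proof -
  from assms(1) obtain \<sigma> where q: "q = \<sigma> 0 + (\<Sum>j=1..m. \<sigma> j * g j)" and \<sigma>: "\<forall>j\<in>{0..m}. \<sigma> j \<in> sos U"
    unfolding quad_module_def by blast
  have "0 \<le> peval x (\<sigma> j)" if "j \<in> {0..m}" for j using that \<sigma> peval_sos_nonneg by blast
  then show ?thesis
    unfolding q using assms(2) by (auto simp: peval_hom intro!: add_nonneg_nonneg sum_nonneg mult_nonneg_nonneg)
qed

lemma trunc_quad_module_subset: "trunc_quad_module U m g d \<subseteq> quad_module U m g"
  unfolding trunc_quad_module_def quad_module_def by blast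

text \<open>Pulling the module in \<open>polys U\<close> back along restriction gives a quadratic module of the full
  polynomial ring, so that no separate theory of the rings \<open>polys U\<close> is required.\<close>

lemma quadratic_module_preimage:
  "quadratic_module {q. prestrict U q \<in> quad_module U m g}"
  unfolding quadratic_module_def
proof (intro conjI ballI allI)
  have one: "1 \<in> sos U"
    using sos_square[of 1 U] by (simp add: polys_iff_prestrict prestrict_hom)
  have "(1 :: 'a rpoly) = (\<lambda>j. if j = 0 then 1 else 0) 0 + (\<Sum>j=1..m. (\<lambda>j. if j = 0 then 1 else 0) j * g j)"
    by simp
  moreover have "\<forall>j\<in>{0..m}. (\<lambda>j. if j = 0 then 1 else 0) j \<in> sos U"
    using one by (simp add: sos_zero)
  ultimately have "1 \<in> quad_module U m g"
    unfolding quad_module_def mem_Collect_eq by (intro exI[of _ "\<lambda>j. if j = 0 then 1 else 0"] conjI)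
  then show "1 \<in> {q. prestrict U q \<in> quad_module U m g}" by (simp add: prestrict_hom)
next
  fix p q assume "p \<in> {q. prestrict U q \<in> quad_module U m g}" "q \<in> {q. prestrict U q \<in> quad_module U m g}"
  then obtain \<sigma> \<tau> where
    p: "prestrict U p = \<sigma> 0 + (\<Sum>j=1..m. \<sigma> j * g j)" "\<forall>j\<in>{0..m}. \<sigma> j \<in> sos U" and
    q: "prestrict U q = \<tau> 0 + (\<Sum>j=1..m. \<tau> j * g j)" "\<forall>j\<in>{0..m}. \<tau> j \<in> sos U"
    unfolding quad_module_def by blast
  have "prestrict U (p + q) = (\<sigma> 0 + \<tau> 0) + (\<Sum>j=1..m. (\<sigma> j + \<tau> j) * g j)"
    by (simp add: prestrict_hom p(1) q(1) distrib_right sum.distrib)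
  moreover have "\<forall>j\<in>{0..m}. \<sigma> j + \<tau> j \<in> sos U" using p(2) q(2) sos_add by blast
  ultimately have "prestrict U (p + q) \<in> quad_module U m g"
    unfolding quad_module_def mem_Collect_eq by (intro exI[of _ "\<lambda>j. \<sigma> j + \<tau> j"] conjI)
  then show "p + q \<in> {q. prestrict U q \<in> quad_module U m g}" by simp
next
  fix a q assume "q \<in> {q. prestrict U q \<in> quad_module U m g}"
  then obtain \<tau> where
    q: "prestrict U q = \<tau> 0 + (\<Sum>j=1..m. \<tau> j * g j)" "\<forall>j\<in>{0..m}. \<tau> j \<in> sos U"
    unfolding quad_module_def by blast
  have "prestrict U (a ^ 2 * q) = prestrict U a ^ 2 * \<tau> 0 + (\<Sum>j=1..m. prestrict U a ^ 2 * \<tau> j * g j)"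
    by (simp add: prestrict_hom q(1) distrib_left sum_distrib_left mult.assoc)
  moreover have "\<forall>j\<in>{0..m}. prestrict U a ^ 2 * \<tau> j \<in> sos U"
    using q(2) sos_square_mult[OF prestrict_in_polys] by blast
  ultimately have "prestrict U (a ^ 2 * q) \<in> quad_module U m g"
    unfolding quad_module_def mem_Collect_eq by (intro exI[of _ "\<lambda>j. prestrict U a ^ 2 * \<tau> j"] conjI)
  then show "a ^ 2 * q \<in> {q. prestrict U q \<in> quad_module U m g}" by simp
qed

lemma quad_module_generator:
  assumes "j \<in> {1..m}" shows "g j \<in> quad_module U m g"
proof -
  define \<sigma> :: "nat \<Rightarrow> 'a rpoly" where "\<sigma> i = (if i = j then 1 else 0)" for i
  have "g j = \<sigma> 0 + (\<Sum>i=1..m. \<sigma> i * g i)"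
  proof -
    have "(\<Sum>i=1..m. \<sigma> i * g i) = (\<Sum>i=1..m. if i = j then g i else 0)"
      by (intro sum.cong) (auto simp: \<sigma>_def)
    then show ?thesis using assms by (simp add: \<sigma>_def)
  qed
  moreover have "\<forall>i\<in>{0..m}. \<sigma> i \<in> sos U"
    using sos_square[of 1 U] by (simp add: \<sigma>_def sos_zero polys_iff_prestrict prestrict_hom)
  ultimately show ?thesis
    unfolding quad_module_def mem_Collect_eq by (intro exI[of _ \<sigma>] conjI)
qed

text \<open>Putinar's theorem in the variables \<open>U\<close>. The preimage module contains \<open>\<plusminus> pvar i\<close> for \<open>i \<notin> U\<close>, because
  their restrictions vanish. Hence the points at which it is nonnegative are supported in \<open>U\<close>. It
  also contains the unrestricted module, from which it inherits the Archimedean property.\<close>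

theorem putinar_prestrict:
  fixes g :: "nat \<Rightarrow> 'n::finite rpoly"
  assumes arch: "archimedean_module m g"
    and pos: "\<And>x. (\<And>i. i \<notin> U \<Longrightarrow> x $ i = 0) \<Longrightarrow> (\<And>j. j \<in> {1..m} \<Longrightarrow> 0 \<le> peval x (g j)) \<Longrightarrow> 0 < peval x h"
  shows "prestrict U h \<in> quad_module U m (\<lambda>j. prestrict U (g j))"
proof -
  let ?Q = "{q. prestrict U q \<in> quad_module U m (\<lambda>j. prestrict U (g j))}"
  have Q: "quadratic_module ?Q" by (rule quadratic_module_preimage)
  obtain R where "pconst R - (\<Sum>i\<in>UNIV. pvar i ^ 2) \<in> quad_module UNIV m g"
    using arch unfolding archimedean_module_def by blast
  then have R: "pconst R - (\<Sum>i\<in>UNIV. pvar i ^ 2) \<in> ?Q"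
    using quad_module_prestrict by blast
  have "h \<in> ?Q"
  proof (rule putinar[OF Q R])
    fix x :: "real ^ 'n" assume x: "\<And>q. q \<in> ?Q \<Longrightarrow> 0 \<le> peval x q"
    show "0 < peval x h"
    proof (rule pos)
      fix i assume "i \<notin> U"
      have zero: "0 \<in> ?Q" by (rule quadratic_module_zero[OF Q])
      have "prestrict U (pvar i) = 0" "prestrict U (0 - pvar i) = 0"
        using \<open>i \<notin> U\<close> by (simp_all only: prestrict_hom if_False diff_zero)
      then have "pvar i \<in> ?Q" "0 - pvar i \<in> ?Q"
        using zero by (simp_all add: prestrict_hom)
      from this[THEN x] show "x $ i = 0" by (simp add: peval_hom del: diff_0)
    next
      fix j assume "j \<in> {1..m}"
      then have "g j \<in> ?Q" using quad_module_generator[of j m "\<lambda>j. prestrict U (g j)" U] by simp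
      then show "0 \<le> peval x (g j)" by (rule x)
    qed
  qed
  then show ?thesis by simp
qed

section \<open>Strict positivity or a vanishing convex combination\<close>

text \<open>Zero is a convex combination of the vectors \<open>(F i s)\<^sub>i\<close> with \<open>s \<in> S\<close>, up to the
  normalisation of the weights. Vectors are families indexed by an arbitrary finite set \<open>I\<close>, so that
  inductions can remove a coordinate.\<close>

definition positively_dependent :: "'i set \<Rightarrow> 'a set \<Rightarrow> ('i \<Rightarrow> 'a \<Rightarrow> real) \<Rightarrow> bool" where
  "positively_dependent I S F \<longleftrightarrow> (\<exists>T w. finite T \<and> T \<noteq> {} \<and> T \<subseteq> S \<and> (\<forall>s\<in>T. 0 < w s) \<and>
     (\<forall>i\<in>I. (\<Sum>s\<in>T. w s * F i s) = 0))"

lemma positively_dependent_mono: "positively_dependent I S F \<Longrightarrow> S \<subseteq> S' \<Longrightarrow> positively_dependent I S' F"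
  unfolding positively_dependent_def by blast

lemma compact_box_fun: "compact {y :: 'i \<Rightarrow> real. \<forall>i. y i \<in> {a..b}}"
proof -
  have "compactin (product_topology (\<lambda>i::'i. euclidean) UNIV) (PiE UNIV (\<lambda>i. {a..b::real}))"
    by (simp add: compactin_PiE)
  then show ?thesis
    by (simp add: euclidean_product_topology PiE_UNIV_domain Pi_def)
qed

text \<open>First-order optimality condition: a minimum at \<open>0\<close> on \<open>[0, 1]\<close> has nonnegative slope.\<close>

lemma quadratic_growth_nonneg:
  fixes d C :: real
  assumes "\<And>\<theta>. 0 < \<theta> \<Longrightarrow> \<theta> \<le> 1 \<Longrightarrow> 0 \<le> 2 * \<theta> * d + \<theta> ^ 2 * C" "0 \<le> C"
  shows "0 \<le> d"
proof (rule ccontr)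
  assume "\<not> 0 \<le> d"
  define \<theta> where "\<theta> = min 1 (- d / (C + 1))"
  have \<theta>: "0 < \<theta>" "\<theta> \<le> 1" using \<open>\<not> 0 \<le> d\<close> assms(2) by (auto simp: \<theta>_def divide_neg_pos)
  have "\<theta> * (C + 1) \<le> - d / (C + 1) * (C + 1)"
    using assms(2) by (intro mult_right_mono) (auto simp: \<theta>_def)
  also have "\<dots> = - d" using assms(2) by simp
  finally have "2 * d + \<theta> * C < 0" using \<open>\<not> 0 \<le> d\<close> \<theta> by (simp add: algebra_simps)
  then have "\<theta> * (2 * d + \<theta> * C) < 0" using \<theta> by (simp add: mult_pos_neg)
  then show False using assms(1)[OF \<theta>] by (simp add: power2_eq_square algebra_simps)
qed

text \<open>The point \<open>y\<close> of minimal norm in the convex hull is nonzero, and moving from it towards any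
  vertex cannot decrease the norm; hence its inner product with each vertex is at least
  \<open>\<parallel>y\<parallel>\<^sup>2 > 0\<close>. The hull is parametrised by the compact simplex of weights.\<close>

lemma gordan_finite:
  fixes F :: "'i \<Rightarrow> 'a \<Rightarrow> real"
  assumes "finite I" "finite T" and nd: "\<not> positively_dependent I T F"
  shows "\<exists>y. \<forall>s\<in>T. 0 < (\<Sum>i\<in>I. y i * F i s)"
proof (cases "T = {}")
  case False
  then obtain s0 where s0: "s0 \<in> T" by blast
  define W where "W = {w :: 'a \<Rightarrow> real. \<forall>s. w s \<in> {0..1}} \<inter> {w. (\<Sum>s\<in>T. w s) = 1}"
  define Y where "Y w i = (\<Sum>s\<in>T. w s * F i s)" for w i
  define q where "q w = (\<Sum>i\<in>I. Y w i ^ 2)" for w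
  have "closed {w :: 'a \<Rightarrow> real. (\<Sum>s\<in>T. w s) = 1}"
    by (intro closed_Collect_eq continuous_intros continuous_on_product_coordinates)
  then have cpt: "compact W"
    unfolding W_def by (intro compact_Int_closed compact_box_fun)
  have "(\<lambda>s. if s = s0 then 1 else 0) \<in> W"
    using s0 \<open>finite T\<close> by (simp add: W_def sum.delta)
  then have ne: "W \<noteq> {}" by blast
  have cont: "continuous_on W q"
    unfolding q_def Y_def
    by (intro continuous_intros continuous_on_subset[OF continuous_on_product_coordinates subset_UNIV])
  obtain w where w: "w \<in> W" and min: "\<And>v. v \<in> W \<Longrightarrow> q w \<le> q v"
    using continuous_attains_inf[OF cpt ne cont] by blast
  have w01: "0 \<le> w s" "w s \<le> 1" for s using w by (auto simp: W_def)
  have wsum: "(\<Sum>s\<in>T. w s) = 1" using w by (simp add: W_def)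
  have qpos: "0 < q w"
  proof (rule ccontr)
    assume "\<not> 0 < q w"
    moreover have "0 \<le> q w" unfolding q_def by (intro sum_nonneg) simp
    ultimately have "q w = 0" by simp
    then have Y0: "Y w i = 0" if "i \<in> I" for i
      using that \<open>finite I\<close> by (simp add: q_def sum_nonneg_eq_0_iff)
    let ?T = "{s \<in> T. 0 < w s}"
    have "(\<Sum>s\<in>?T. w s * F i s) = Y w i" for i
      unfolding Y_def using \<open>finite T\<close> w01
      by (intro sum.mono_neutral_left) (auto simp: less_le)
    moreover have "?T \<noteq> {}"
    proof
      assume "?T = {}"
      then have "w s = 0" if "s \<in> T" for s using that w01[of s] by (auto simp: less_le)
      then show False using wsum by simp
    qed
    ultimately have "positively_dependent I T F"
      unfolding positively_dependent_def using Y0 \<open>finite T\<close>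
      by (intro exI[of _ ?T] exI[of _ w]) auto
    with nd show False by blast
  qed
  have "0 < (\<Sum>i\<in>I. Y w i * F i t)" if t: "t \<in> T" for t
  proof -
    have "0 \<le> (\<Sum>i\<in>I. Y w i * F i t) - q w"
    proof (rule quadratic_growth_nonneg[of _ "\<Sum>i\<in>I. (F i t - Y w i) ^ 2"])
      fix \<theta> :: real assume \<theta>: "0 < \<theta>" "\<theta> \<le> 1"
      define v where "v s = (1 - \<theta>) * w s + \<theta> * (if s = t then 1 else 0)" for s
      have "v s \<le> (1 - \<theta>) * 1 + \<theta> * 1" for s
        unfolding v_def using \<theta> w01 by (intro add_mono mult_left_mono) auto
      moreover have "0 \<le> v s" for s using \<theta> w01 by (simp add: v_def)
      moreover have "(\<Sum>s\<in>T. v s) = 1"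
        using t \<open>finite T\<close> wsum by (simp add: v_def sum.distrib flip: sum_distrib_left)
      ultimately have "v \<in> W" by (simp add: W_def)
      have Yv: "Y v i = Y w i + \<theta> * (F i t - Y w i)" for i
      proof -
        have "Y v i = (\<Sum>s\<in>T. (1 - \<theta>) * (w s * F i s) + \<theta> * (if s = t then F i s else 0))"
          unfolding Y_def v_def by (intro sum.cong) (auto simp: algebra_simps)
        also have "\<dots> = (1 - \<theta>) * Y w i + \<theta> * F i t"
          using t \<open>finite T\<close> by (simp add: Y_def sum.distrib flip: sum_distrib_left)
        finally show ?thesis by (simp add: algebra_simps)
      qed
      have "q v = (\<Sum>i\<in>I. Y w i ^ 2 + 2 * \<theta> * (Y w i * F i t - Y w i ^ 2) + \<theta> ^ 2 * (F i t - Y w i) ^ 2)"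
        unfolding q_def Yv by (intro sum.cong) (auto simp: power2_eq_square algebra_simps)
      also have "\<dots> = q w + 2 * \<theta> * ((\<Sum>i\<in>I. Y w i * F i t) - q w) + \<theta> ^ 2 * (\<Sum>i\<in>I. (F i t - Y w i) ^ 2)"
        by (simp add: q_def sum.distrib sum_subtractf flip: sum_distrib_left)
      finally show "0 \<le> 2 * \<theta> * ((\<Sum>i\<in>I. Y w i * F i t) - q w) + \<theta> ^ 2 * (\<Sum>i\<in>I. (F i t - Y w i) ^ 2)"
        using min[OF \<open>v \<in> W\<close>] by simp
    qed (simp add: sum_nonneg)
    then show ?thesis using qpos by simp
  qed
  then show ?thesis by blast
qed simp

text \<open>For infinite \<open>S\<close> only weak separation survives. The normalised \<open>y\<close> with \<open>0 \<le> (\<Sum>i\<in>I. y i * F i s)\<close> form a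
  closed subset of a compact sphere, and by \<open>gordan_finite\<close> finitely many of these sets always meet.\<close>

lemma gordan_weak:
  fixes F :: "'i \<Rightarrow> 'a \<Rightarrow> real"
  assumes I: "finite I" "I \<noteq> {}" and nd: "\<not> positively_dependent I S F"
  obtains y where "\<exists>i\<in>I. y i \<noteq> 0" "\<And>s. s \<in> S \<Longrightarrow> 0 \<le> (\<Sum>i\<in>I. y i * F i s)"
proof -
  \<comment> \<open>The box in \<open>B\<close> also constrains coordinates outside \<open>I\<close>, which makes \<open>B\<close> compact in the product topology.\<close>
  define B where "B = {y :: 'i \<Rightarrow> real. \<forall>i. y i \<in> {-1..1}} \<inter> {y. (\<Sum>i\<in>I. \<bar>y i\<bar>) = 1}"
  define C where "C s = {y :: 'i \<Rightarrow> real. 0 \<le> (\<Sum>i\<in>I. y i * F i s)}" for s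
  have "closed {y :: 'i \<Rightarrow> real. (\<Sum>i\<in>I. \<bar>y i\<bar>) = 1}"
    by (intro closed_Collect_eq continuous_intros continuous_on_product_coordinates)
  then have "compact B"
    unfolding B_def by (intro compact_Int_closed compact_box_fun)
  have closed: "closed (C s)" for s
    unfolding C_def by (intro closed_Collect_le continuous_intros continuous_on_product_coordinates)
  have normalise: "\<exists>y'\<in>B. \<exists>k>0. \<forall>i\<in>I. y' i = k * y i" if "\<exists>i\<in>I. y i \<noteq> 0" for y :: "'i \<Rightarrow> real"
  proof -
    define n where "n = (\<Sum>i\<in>I. \<bar>y i\<bar>)"
    from that obtain i where "i \<in> I" "y i \<noteq> 0" by blast
    then have n: "0 < n" unfolding n_def using I by (intro sum_pos2[of I i]) auto
    define y' where "y' i = (if i \<in> I then y i / n else 0)" for i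
    have le: "\<bar>y i\<bar> \<le> n" if "i \<in> I" for i
      unfolding n_def using I that by (intro member_le_sum) auto
    have "\<bar>y' i\<bar> \<le> 1" for i
      using le n by (auto simp: y'_def abs_divide)
    then have "y' i \<in> {-1..1}" for i by (auto simp: abs_le_iff minus_le_iff)
    moreover have "(\<Sum>i\<in>I. \<bar>y' i\<bar>) = 1"
      using n by (simp add: y'_def abs_divide n_def flip: sum_divide_distrib)
    ultimately have "y' \<in> B" by (simp add: B_def)
    moreover have "\<forall>i\<in>I. y' i = (1 / n) * y i" by (simp add: y'_def)
    ultimately show ?thesis using n by (intro bexI[of _ y'] exI[of _ "1 / n"]) auto
  qed
  have "B \<inter> \<Inter> (C ` S) \<noteq> {}"
  proof (rule compact_imp_fip[OF \<open>compact B\<close>])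
    fix \<C>' assume "finite \<C>'" "\<C>' \<subseteq> C ` S"
    then obtain T where T: "T \<subseteq> S" "finite T" "\<C>' = C ` T" by (meson finite_subset_image)
    have "\<exists>y. (\<exists>i\<in>I. y i \<noteq> 0) \<and> (\<forall>s\<in>T. 0 \<le> (\<Sum>i\<in>I. y i * F i s))"
    proof (cases "T = {}")
      case True
      with I(2) show ?thesis by (intro exI[of _ "\<lambda>_. 1"]) auto
    next
      case False
      then obtain t where t: "t \<in> T" by blast
      have "\<not> positively_dependent I T F" using nd T(1) positively_dependent_mono by blast
      then obtain y where y: "\<And>s. s \<in> T \<Longrightarrow> 0 < (\<Sum>i\<in>I. y i * F i s)"
        using gordan_finite[OF I(1) T(2)] by blast
      have "\<exists>i\<in>I. y i \<noteq> 0"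
      proof (rule ccontr)
        assume "\<not> ?thesis"
        then have "(\<Sum>i\<in>I. y i * F i t) = 0" by simp
        with y[OF t] show False by simp
      qed
      then show ?thesis using y less_imp_le by blast
    qed
    then obtain y where y: "\<exists>i\<in>I. y i \<noteq> 0" "\<And>s. s \<in> T \<Longrightarrow> 0 \<le> (\<Sum>i\<in>I. y i * F i s)" by blast
    from normalise[OF y(1)] obtain y' k where y': "y' \<in> B" "k > 0" "\<forall>i\<in>I. y' i = k * y i" by blast
    have "(\<Sum>i\<in>I. y' i * F i s) = k * (\<Sum>i\<in>I. y i * F i s)" for s
      using y'(3) by (simp add: sum_distrib_left mult.assoc)
    then have "y' \<in> C s" if "s \<in> T" for s
      using y(2)[OF that] y'(2) by (simp add: C_def)
    with y'(1) T(3) show "B \<inter> \<Inter> \<C>' \<noteq> {}" by blast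
  qed (use closed in auto)
  then obtain y where y: "y \<in> B" "\<And>s. s \<in> S \<Longrightarrow> y \<in> C s" by blast
  have "\<exists>i\<in>I. y i \<noteq> 0"
  proof (rule ccontr)
    assume "\<not> ?thesis"
    then have "(\<Sum>i\<in>I. \<bar>y i\<bar>) = 0" by simp
    with y(1) show False by (simp add: B_def)
  qed
  with y(2) that show ?thesis by (auto simp: C_def)
qed

text \<open>On the hyperplane \<open>(\<Sum>i\<in>I. y i * F i s) = 0\<close> with \<open>y j \<noteq> 0\<close> the coordinate \<open>j\<close> is a linear combination of the
  others, so it may be dropped. This drives both inductions on the number of coordinates below.\<close>

lemma positively_dependent_eliminate:
  assumes I: "finite I" "j \<in> I" "y j \<noteq> 0" and y: "\<And>s. s \<in> S \<Longrightarrow> (\<Sum>i\<in>I. y i * F i s) = 0"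
    and dep: "positively_dependent (I - {j}) S F"
  shows "positively_dependent I S F"
proof -
  from dep obtain T w where T: "finite T" "T \<noteq> {}" "T \<subseteq> S" "\<forall>s\<in>T. 0 < w s"
    and w: "\<And>i. i \<in> I - {j} \<Longrightarrow> (\<Sum>s\<in>T. w s * F i s) = 0"
    unfolding positively_dependent_def by blast
  have "0 = (\<Sum>s\<in>T. w s * (\<Sum>i\<in>I. y i * F i s))"
    using y T(3) by (simp add: subset_iff)
  also have "\<dots> = (\<Sum>s\<in>T. \<Sum>i\<in>I. y i * (w s * F i s))"
    by (simp add: sum_distrib_left mult.left_commute)
  also have "\<dots> = (\<Sum>i\<in>I. y i * (\<Sum>s\<in>T. w s * F i s))"
    by (subst sum.swap) (simp add: sum_distrib_left)
  also have "\<dots> = y j * (\<Sum>s\<in>T. w s * F j s)"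
    using I(1,2) w by (simp add: sum.remove)
  finally have "(\<Sum>s\<in>T. w s * F j s) = 0" using I(3) by simp
  with w have "\<forall>i\<in>I. (\<Sum>s\<in>T. w s * F i s) = 0" by blast
  with T show ?thesis unfolding positively_dependent_def by blast
qed

text \<open>A weakly separating form \<open>h\<close> is strict except on a compact set, where one coordinate is redundant
  and induction gives a form \<open>h'\<close> that is strict there; by compactness \<open>k * h + h'\<close> is strict
  everywhere for large \<open>k\<close>.\<close>

lemma gordan_compact:
  fixes F :: "'i \<Rightarrow> 'a::t2_space \<Rightarrow> real"
  assumes "finite I" "compact S" and cont: "\<And>i. continuous_on UNIV (F i)"
    and "\<not> positively_dependent I S F"
  shows "\<exists>y. \<forall>s\<in>S. 0 < (\<Sum>i\<in>I. y i * F i s)"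
  using assms(1,2,4)
proof (induction I arbitrary: S rule: finite_psubset_induct)
  case (psubset I)
  show ?case
  proof (cases "I = {}")
    case True
    have "S = {}"
    proof (rule ccontr)
      assume "S \<noteq> {}"
      then obtain s where "s \<in> S" by blast
      then have "positively_dependent I S F"
        unfolding positively_dependent_def True by (intro exI[of _ "{s}"] exI[of _ "\<lambda>_. 1"]) simp
      with psubset.prems show False by blast
    qed
    then show ?thesis by simp
  next
    case False
    obtain y where y0: "\<exists>i\<in>I. y i \<noteq> 0" and y: "\<And>s. s \<in> S \<Longrightarrow> 0 \<le> (\<Sum>i\<in>I. y i * F i s)"
      using gordan_weak[OF psubset.hyps(1) False psubset.prems(2)] by blast
    from y0 obtain j where j: "j \<in> I" "y j \<noteq> 0" by blast
    define h where "h s = (\<Sum>i\<in>I. y i * F i s)" for s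
    have conth: "continuous_on A h" for A
      unfolding h_def by (intro continuous_intros continuous_on_subset[OF cont]) auto
    let ?S' = "S \<inter> {s. h s = 0}"
    have "compact ?S'"
      using psubset.prems(1) conth by (intro compact_Int_closed closed_Collect_eq) auto
    moreover have "\<not> positively_dependent (I - {j}) ?S' F"
    proof
      assume "positively_dependent (I - {j}) ?S' F"
      then have "positively_dependent I ?S' F"
        by (rule positively_dependent_eliminate[where y = y and j = j, rotated -1])
          (use psubset.hyps(1) j in \<open>auto simp: h_def\<close>)
      then show False using psubset.prems(2) positively_dependent_mono by blast
    qed
    ultimately obtain y' where y': "\<And>s. s \<in> ?S' \<Longrightarrow> 0 < (\<Sum>i\<in>I - {j}. y' i * F i s)"
      using psubset.IH[of "I - {j}" ?S'] j(1) by blast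
    define h' where "h' s = (\<Sum>i\<in>I - {j}. y' i * F i s)" for s
    have conth': "continuous_on A h'" for A
      unfolding h'_def by (intro continuous_intros continuous_on_subset[OF cont]) auto
    define Z where "Z = S \<inter> {s. h' s \<le> 0}"
    have "compact Z"
      unfolding Z_def using psubset.prems(1) conth' by (intro compact_Int_closed closed_Collect_le) auto
    have hZ: "0 < h s" if "s \<in> Z" for s
      using that y[of s] y'[of s] unfolding Z_def h_def h'_def by force
    have "\<exists>k\<ge>0. \<forall>s\<in>Z. 0 < k * h s + h' s"
    proof (cases "Z = {}")
      case False
      obtain a where a: "a \<in> Z" "\<And>s. s \<in> Z \<Longrightarrow> h a \<le> h s"
        using continuous_attains_inf[OF \<open>compact Z\<close> False conth] by blast
      obtain b where b: "b \<in> Z" "\<And>s. s \<in> Z \<Longrightarrow> h' b \<le> h' s"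
        using continuous_attains_inf[OF \<open>compact Z\<close> False conth'] by blast
      \<comment> \<open>On \<open>Z\<close>, where \<open>h'\<close> may be negative, \<open>h\<close> is bounded below by \<open>h a > 0\<close>.\<close>
      define k where "k = (1 + \<bar>h' b\<bar>) / h a"
      have ha: "0 < h a" using hZ a(1) by blast
      then have "0 \<le> k" by (simp add: k_def)
      moreover have "0 < k * h s + h' s" if "s \<in> Z" for s
      proof -
        have "1 + \<bar>h' b\<bar> = k * h a" using ha by (simp add: k_def)
        also have "\<dots> \<le> k * h s" using \<open>0 \<le> k\<close> a(2)[OF that] by (rule mult_left_mono[rotated])
        finally show ?thesis using b(2)[OF that] by linarith
      qed
      ultimately show ?thesis by blast
    qed auto
    then obtain k where k: "k \<ge> 0" "\<And>s. s \<in> Z \<Longrightarrow> 0 < k * h s + h' s" by blast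
    define z where "z i = k * y i + (if i = j then 0 else y' i)" for i
    have "0 < (\<Sum>i\<in>I. z i * F i s)" if "s \<in> S" for s
    proof -
      have "h' s = (\<Sum>i\<in>I. (if i = j then 0 else y' i) * F i s)"
        unfolding h'_def using psubset.hyps(1) by (intro sum.mono_neutral_cong_left) auto
      then have "(\<Sum>i\<in>I. z i * F i s) = k * h s + h' s"
        by (simp add: z_def h_def sum_distrib_left distrib_right sum.distrib mult.assoc)
      moreover have "0 < k * h s + h' s"
      proof (cases "s \<in> Z")
        case False
        then have "0 < h' s" using that by (simp add: Z_def)
        moreover have "0 \<le> k * h s" using k(1) y[OF that] by (simp add: h_def)
        ultimately show ?thesis by simp
      qed (rule k(2))
      ultimately show ?thesis by simp
    qed
    then show ?thesis by blast
  qed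
qed

text \<open>The barycentre of a measure lies in the convex hull itself, not only in its closure: a weakly
  separating form is nonnegative with integral zero, hence vanishes almost everywhere, so the
  measure lives on a hyperplane and a coordinate can be eliminated.\<close>

lemma zero_means_positively_dependent:
  fixes F :: "'i \<Rightarrow> 'a \<Rightarrow> real"
  assumes "finite_measure M" and nz: "emeasure M (space M) \<noteq> 0"
    and "finite I" "K \<in> sets M" "AE x in M. x \<in> K"
    and "\<And>i. i \<in> I \<Longrightarrow> integrable M (F i)" "\<And>i. i \<in> I \<Longrightarrow> (\<integral>x. F i x \<partial>M) = 0"
  shows "positively_dependent I K F"
  using assms(3-7)
proof (induction I arbitrary: K rule: finite_psubset_induct)
  case (psubset I)
  have "K \<noteq> {}"
  proof
    assume "K = {}"
    with psubset.prems(2) have "AE x in M. False" by simp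
    with nz show False by (simp add: eventually_False ae_filter_eq_bot_iff)
  qed
  show ?case
  proof (cases "I = {}")
    case True
    from \<open>K \<noteq> {}\<close> obtain s where "s \<in> K" by blast
    then show ?thesis
      unfolding positively_dependent_def True by (intro exI[of _ "{s}"] exI[of _ "\<lambda>_. 1"]) simp
  next
    case False
    show ?thesis
    proof (rule ccontr)
      assume nd: "\<not> ?thesis"
      obtain y where y0: "\<exists>i\<in>I. y i \<noteq> 0" and y: "\<And>s. s \<in> K \<Longrightarrow> 0 \<le> (\<Sum>i\<in>I. y i * F i s)"
        using gordan_weak[OF psubset.hyps(1) False nd] by blast
      from y0 obtain j where j: "j \<in> I" "y j \<noteq> 0" by blast
      define h where "h s = (\<Sum>i\<in>I. y i * F i s)" for s
      have inth: "integrable M h" unfolding h_def using psubset.prems(3) by auto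
      have "(\<integral>x. h x \<partial>M) = 0" unfolding h_def
        using psubset.prems(3,4) by (subst Bochner_Integration.integral_sum) auto
      moreover have "AE x in M. 0 \<le> h x" using psubset.prems(2) y by (auto simp: h_def)
      ultimately have h0: "AE x in M. h x = 0"
        using integral_nonneg_eq_0_iff_AE[OF inth] by simp
      have "h \<in> borel_measurable M" using inth by simp
      then have "{x \<in> space M. h x = 0} \<in> sets M" by measurable
      then have sets: "K \<inter> {x \<in> space M. h x = 0} \<in> sets M" using psubset.prems(1) by blast
      have "AE x in M. x \<in> K \<inter> {x \<in> space M. h x = 0}"
        using psubset.prems(2) h0 AE_space by eventually_elim auto
      then have "positively_dependent (I - {j}) (K \<inter> {x \<in> space M. h x = 0}) F"
        using psubset.prems(3,4) j(1) sets by (intro psubset.IH) auto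
      then have "positively_dependent I (K \<inter> {x \<in> space M. h x = 0}) F"
        by (rule positively_dependent_eliminate[where y = y and j = j, rotated -1])
          (use psubset.hyps(1) j in \<open>auto simp: h_def\<close>)
      then show False using nd positively_dependent_mono by blast
    qed
  qed
qed

text \<open>Richter's generalisation of Tchakaloff's theorem, obtained by centring each function at its
  mean.\<close>

theorem tchakaloff:
  fixes F :: "'i \<Rightarrow> 'a \<Rightarrow> real"
  assumes M: "finite_measure M" and I: "finite I" and K: "K \<in> sets M" "AE x in M. x \<in> K"
    and F: "\<And>i. i \<in> I \<Longrightarrow> integrable M (F i)"
  shows "\<exists>T w. finite T \<and> T \<subseteq> K \<and> (\<forall>s\<in>T. 0 \<le> w s) \<and>
    (\<forall>i\<in>I. (\<Sum>s\<in>T. w s * F i s) = (\<integral>x. F i x \<partial>M))"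
proof (cases "emeasure M (space M) = 0")
  case True
  have "(\<integral>x. F i x \<partial>M) = 0" if "i \<in> I" for i
  proof -
    have "AE x in M. F i x = 0" using True
      by (intro AE_I[of _ _ "space M"]) auto
    then show ?thesis by (simp add: integral_eq_zero_AE)
  qed
  then show ?thesis by (intro exI[of _ "{}"]) simp
next
  case False
  interpret finite_measure M by fact
  define \<mu> where "\<mu> = measure M (space M)"
  have \<mu>: "0 < \<mu>" using False unfolding \<mu>_def
    by (simp add: emeasure_eq_measure zero_less_measure_iff)
  define G where "G i x = F i x - (\<integral>x. F i x \<partial>M) / \<mu>" for i x
  have "positively_dependent I K G"
  proof (rule zero_means_positively_dependent[OF M False I K])
    fix i assume i: "i \<in> I"
    then show "integrable M (G i)" unfolding G_def using F by auto
    show "(\<integral>x. G i x \<partial>M) = 0" unfolding G_def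
      using F[OF i] \<mu> by (simp add: \<mu>_def)
  qed
  then obtain T w where T: "finite T" "T \<noteq> {}" "T \<subseteq> K" "\<And>s. s \<in> T \<Longrightarrow> 0 < w s"
    and w: "\<And>i. i \<in> I \<Longrightarrow> (\<Sum>s\<in>T. w s * G i s) = 0"
    unfolding positively_dependent_def by blast
  define W where "W = sum w T"
  have W: "0 < W" unfolding W_def using T by (intro sum_pos) auto
  show ?thesis
  proof (intro exI[of _ T] exI[of _ "\<lambda>s. \<mu> / W * w s"] conjI ballI)
    fix i assume i: "i \<in> I"
    have "(\<Sum>s\<in>T. w s * G i s) = (\<Sum>s\<in>T. w s * F i s) - W * ((\<integral>x. F i x \<partial>M) / \<mu>)"
      by (simp only: G_def W_def right_diff_distrib sum_subtractf sum_distrib_right)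
    with w[OF i] have "(\<Sum>s\<in>T. w s * F i s) = W * ((\<integral>x. F i x \<partial>M) / \<mu>)" by simp
    moreover have "(\<Sum>s\<in>T. \<mu> / W * w s * F i s) = \<mu> / W * (\<Sum>s\<in>T. w s * F i s)"
      by (simp add: sum_distrib_left mult.assoc)
    ultimately show "(\<Sum>s\<in>T. \<mu> / W * w s * F i s) = (\<integral>x. F i x \<partial>M)"
      using \<mu> W by simp
  qed (use T \<mu> W in \<open>auto simp: less_imp_le\<close>)
qed

section \<open>Cliques and the feasible set\<close>

lemma clique_subset_max_clique:
  fixes E :: "'n::finite set set"
  assumes "clique E C" obtains D where "D \<in> max_cliques E" "C \<subseteq> D"
proof -
  have "\<exists>D\<in>{D. clique E D}. C \<subseteq> D \<and> (\<forall>D'\<in>{D. clique E D}. D \<subseteq> D' \<longrightarrow> D = D')"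
    using assms by (intro finite_has_maximal2) auto
  then show ?thesis using that unfolding max_cliques_def by blast
qed

lemma feas_set_support_clique:
  assumes "x \<in> feas_set E m g" shows "clique E {i. x $ i \<noteq> 0}"
  using assms unfolding feas_set_def clique_def by auto

lemma clique_supported_feasible:
  assumes "clique E C" "\<And>i. i \<notin> C \<Longrightarrow> x $ i = 0" "\<And>j. j \<in> {1..m} \<Longrightarrow> 0 \<le> peval x (g j)"
  shows "x \<in> feas_set E m g"
  using assms unfolding feas_set_def clique_def by fastforce

lemma closed_feas_set: "closed (feas_set E m g)"
proof -
  have "feas_set E m g = (\<Inter>j\<in>{1..m}. {x. 0 \<le> peval x (g j)}) \<inter>
      (\<Inter>(i, j)\<in>{(i, j). i \<noteq> j \<and> {i, j} \<notin> E}. {x. x $ i * x $ j = 0})"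
    unfolding feas_set_def by auto
  moreover have "closed {x. 0 \<le> peval x (g j)}" for j
    by (intro closed_Collect_le continuous_intros)
  moreover have "closed {x :: real ^ 'a. x $ i * x $ j = 0}" for i j
    by (intro closed_Collect_eq continuous_intros)
  ultimately show ?thesis by (auto intro!: closed_Int closed_INT)
qed

lemma compact_feas_set:
  assumes "archimedean_module m g" shows "compact (feas_set E m g)"
proof -
  from assms obtain R where R: "pconst R - (\<Sum>i\<in>UNIV. pvar i ^ 2) \<in> quad_module UNIV m g"
    unfolding archimedean_module_def by blast
  have "norm x \<le> sqrt R" if "x \<in> feas_set E m g" for x
  proof -
    have "0 \<le> peval x (pconst R - (\<Sum>i\<in>UNIV. pvar i ^ 2))"
      using R that unfolding feas_set_def by (intro peval_quad_module_nonneg) auto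
    then have "(\<Sum>i\<in>UNIV. (x $ i) ^ 2) \<le> R" by (simp add: peval_hom)
    then show ?thesis by (simp add: norm_vec_def L2_set_def)
  qed
  then have "bounded (feas_set E m g)" unfolding bounded_iff by blast
  with closed_feas_set show ?thesis by (simp add: compact_eq_bounded_closed)
qed

section \<open>The moment problem over finitely atomic measures\<close>

text \<open>Feasibility of the measure \<open>\<Sum>x\<in>T. w x * \<delta>\<^sub>x\<close> for the moment problem.\<close>

definition atomic_feasible ::
    "'n::finite set set \<Rightarrow> nat \<Rightarrow> (nat \<Rightarrow> 'n rpoly) \<Rightarrow> nat \<Rightarrow> (nat \<Rightarrow> 'n rpoly) \<Rightarrow> (nat \<Rightarrow> real) \<Rightarrow>
     (real ^ 'n) set \<Rightarrow> (real ^ 'n \<Rightarrow> real) \<Rightarrow> bool" where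
  "atomic_feasible E m g N f a T w \<longleftrightarrow> finite T \<and> T \<subseteq> feas_set E m g \<and> (\<forall>x\<in>T. 0 \<le> w x) \<and>
     (\<forall>i\<in>{1..N}. (\<Sum>x\<in>T. w x * peval x (f i)) = a i)"

text \<open>By second countability the complement of the support is a countable union of open null sets.\<close>

lemma AE_msupport:
  fixes \<mu> :: "'a::second_countable_topology measure"
  assumes sets: "sets \<mu> = sets borel"
  shows "AE x in \<mu>. x \<in> msupport \<mu>"
proof -
  obtain B :: "'a set set" where B: "countable B" "topological_basis B"
    using ex_countable_basis by blast
  let ?N = "{S \<in> B. emeasure \<mu> S = 0}"
  have "S \<in> null_sets \<mu>" if "S \<in> ?N" for S
    using that topological_basis_open[OF B(2)] sets by (auto intro!: null_setsI)
  moreover have "countable ?N" using B(1) by (rule countable_subset[rotated]) auto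
  ultimately have "(\<Union>S\<in>?N. S) \<in> null_sets \<mu>" by (intro null_sets_UN') auto
  moreover have "{x \<in> space \<mu>. x \<notin> msupport \<mu>} \<subseteq> (\<Union>S\<in>?N. S)"
  proof
    fix x assume "x \<in> {x \<in> space \<mu>. x \<notin> msupport \<mu>}"
    then obtain S where S: "open S" "x \<in> S" "emeasure \<mu> S = 0"
      unfolding msupport_def by (auto simp: not_gr_zero)
    then obtain S' where S': "S' \<in> B" "x \<in> S'" "S' \<subseteq> S"
      using topological_basisE[OF B(2)] by metis
    then have "emeasure \<mu> S' \<le> emeasure \<mu> S"
      using S(1) sets by (intro emeasure_mono) auto
    with S(3) S' show "x \<in> (\<Union>S\<in>?N. S)" by auto
  qed
  ultimately show ?thesis by (rule AE_I')
qed

lemma borel_measurable_peval [measurable]: "(\<lambda>x. peval x p) \<in> borel_measurable borel"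
  by (intro borel_measurable_continuous_onI continuous_intros)

text \<open>Finitely atomic measures suffice: they are feasible measures, and any feasible measure can be
  replaced by an atomic one with the same integrals of \<open>f 0, \<dots>, f N\<close>. After this lemma no
  measure theory is used.\<close>

lemma gmp_val_eq_atomic:
  "gmp_val E m g N f a = Inf {ereal (\<Sum>x\<in>T. w x * peval x (f 0)) | T w. atomic_feasible E m g N f a T w}"
  (is "_ = Inf ?A")
proof (rule antisym)
  show "gmp_val E m g N f a \<le> Inf ?A"
  proof (rule Inf_greatest)
    fix v assume "v \<in> ?A"
    then obtain T w where v: "v = ereal (\<Sum>x\<in>T. w x * peval x (f 0))"
      and T: "finite T" "T \<subseteq> feas_set E m g" and w: "\<And>x. x \<in> T \<Longrightarrow> 0 \<le> w x"
      and mom: "\<And>i. i \<in> {1..N} \<Longrightarrow> (\<Sum>x\<in>T. w x * peval x (f i)) = a i"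
      unfolding atomic_feasible_def by blast
    define P where "P = point_measure T (\<lambda>x. ennreal (w x))"
    define \<mu> where "\<mu> = distr P borel (\<lambda>x. x)"
    have id: "(\<lambda>x. x) \<in> measurable P borel" unfolding P_def using T(1) by simp
    have int: "integrable \<mu> (\<lambda>x. peval x p)" for p
      unfolding \<mu>_def
      by (subst integrable_distr_eq[OF id borel_measurable_peval])
        (simp add: P_def integrable_point_measure_finite T(1))
    have lint: "(\<integral>x. peval x p \<partial>\<mu>) = (\<Sum>x\<in>T. w x * peval x p)" for p
      unfolding \<mu>_def
      by (subst integral_distr[OF id borel_measurable_peval])
        (simp add: P_def lebesgue_integral_point_measure_finite T(1) w)
    have "finite_measure \<mu>"
    proof (rule finite_measureI)
      have "emeasure \<mu> (space \<mu>) = emeasure P T"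
        unfolding \<mu>_def using emeasure_distr[OF id, of UNIV] by (simp add: P_def space_point_measure)
      also have "\<dots> = (\<Sum>x\<in>T. ennreal (w x))"
        unfolding P_def using T(1) by (simp add: emeasure_point_measure_finite)
      also have "\<dots> \<noteq> \<infinity>" using T(1) by (simp add: ennreal_sum_eq_top)
      finally show "emeasure \<mu> (space \<mu>) \<noteq> \<infinity>" .
    qed
    moreover have "msupport \<mu> \<subseteq> T"
    proof
      fix x assume x: "x \<in> msupport \<mu>"
      show "x \<in> T"
      proof (rule ccontr)
        assume "x \<notin> T"
        moreover have "open (- T)" using T(1) by (simp add: open_Compl finite_imp_closed)
        ultimately have "0 < emeasure \<mu> (- T)" using x unfolding msupport_def by blast
        moreover have "emeasure \<mu> (- T) = emeasure P ((\<lambda>x. x) -` (- T) \<inter> space P)"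
          unfolding \<mu>_def using \<open>open (- T)\<close> by (intro emeasure_distr[OF id]) simp
        moreover have "(\<lambda>x. x) -` (- T) \<inter> space P = {}" by (auto simp: P_def space_point_measure)
        ultimately show False by simp
      qed
    qed
    ultimately show "gmp_val E m g N f a \<le> v"
      unfolding gmp_val_def v using T(2) int lint mom
      by (intro Inf_lower CollectI exI[of _ \<mu>]) (auto simp: \<mu>_def)
  qed
  show "Inf ?A \<le> gmp_val E m g N f a"
    unfolding gmp_val_def
  proof (rule Inf_greatest)
    fix v assume "v \<in> {ereal (\<integral>x. peval x (f 0) \<partial>\<mu>) | \<mu> :: (real ^ 'a) measure.
     sets \<mu> = sets borel \<and> finite_measure \<mu> \<and>
     (\<forall>i\<in>{0..N}. integrable \<mu> (\<lambda>x. peval x (f i))) \<and>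
     (\<forall>i\<in>{1..N}. (\<integral>x. peval x (f i) \<partial>\<mu>) = a i) \<and>
     msupport \<mu> \<subseteq> feas_set E m g}"
    then obtain \<mu> :: "(real ^ 'a) measure" where v: "v = ereal (\<integral>x. peval x (f 0) \<partial>\<mu>)"
      and \<mu>: "sets \<mu> = sets borel" "finite_measure \<mu>"
      and int: "\<forall>i\<in>{0..N}. integrable \<mu> (\<lambda>x. peval x (f i))"
      and mom: "\<forall>i\<in>{1..N}. (\<integral>x. peval x (f i) \<partial>\<mu>) = a i"
      and supp: "msupport \<mu> \<subseteq> feas_set E m g"
      unfolding mem_Collect_eq by (elim exE conjE)
    have K: "feas_set E m g \<in> sets \<mu>" using \<mu>(1) by (simp add: borel_closed closed_feas_set)
    have AEK: "AE x in \<mu>. x \<in> feas_set E m g"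
      using AE_msupport[OF \<mu>(1)] supp by (auto elim: AE_mp)
    have "\<exists>T w. finite T \<and> T \<subseteq> feas_set E m g \<and> (\<forall>s\<in>T. 0 \<le> w s) \<and>
        (\<forall>i\<in>{0..N}. (\<Sum>s\<in>T. w s * peval s (f i)) = (\<integral>x. peval x (f i) \<partial>\<mu>))"
      by (rule tchakaloff[OF \<mu>(2) finite_atLeastAtMost K AEK]) (rule int[rule_format])
    then obtain T w where Tw: "finite T" "T \<subseteq> feas_set E m g" "\<forall>s\<in>T. 0 \<le> w s"
      and eq: "\<forall>i\<in>{0..N}. (\<Sum>s\<in>T. w s * peval s (f i)) = (\<integral>x. peval x (f i) \<partial>\<mu>)"
      by (elim exE conjE)
    have "atomic_feasible E m g N f a T w"
      unfolding atomic_feasible_def using Tw mom eq by simp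
    moreover have "v = ereal (\<Sum>s\<in>T. w s * peval s (f 0))" using eq v by simp
    ultimately show "Inf ?A \<le> v"
      by (intro Inf_lower CollectI exI[of _ T] exI[of _ w] conjI)
  qed
qed

section \<open>Comparing the two relaxations and the moment problem\<close>

lemma functional_on_add: "functional_on U d L \<Longrightarrow> p \<in> polys_le U d \<Longrightarrow> q \<in> polys_le U d \<Longrightarrow> L (p + q) = L p + L q"
  and functional_on_scale: "functional_on U d L \<Longrightarrow> p \<in> polys_le U d \<Longrightarrow> L (pconst r * p) = r * L p"
  by (auto simp: functional_on_def)

lemma functional_on_zero: "functional_on U d L \<Longrightarrow> L 0 = 0"
  using functional_on_scale[of U d L 0 0]
  by (simp add: polys_le_def polys_iff_prestrict prestrict_hom pdeg_le_iff)

lemma functional_on_combination: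
  assumes L: "functional_on U d L" and "finite A" and p: "p \<in> polys_le U d" and q: "\<And>i. i \<in> A \<Longrightarrow> q i \<in> polys_le U d"
  shows "p + (\<Sum>i\<in>A. pconst (y i) * q i) \<in> polys_le U d"
    and "L (p + (\<Sum>i\<in>A. pconst (y i) * q i)) = L p + (\<Sum>i\<in>A. y i * L (q i))"
proof -
  have "p + (\<Sum>i\<in>A. pconst (y i) * q i) \<in> polys_le U d \<and>
      L (p + (\<Sum>i\<in>A. pconst (y i) * q i)) = L p + (\<Sum>i\<in>A. y i * L (q i))"
    using assms(2) q
  proof (induction A)
    case empty
    then show ?case using p by simp
  next
    case (insert j A)
    let ?r = "p + (\<Sum>i\<in>A. pconst (y i) * q i)"
    have r: "?r \<in> polys_le U d" "L ?r = L p + (\<Sum>i\<in>A. y i * L (q i))" using insert by auto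
    have j: "q j \<in> polys_le U d" using insert.prems by simp
    note jy = polys_le_scale[OF j, of "y j"]
    have eq: "p + (\<Sum>i\<in>insert j A. pconst (y i) * q i) = ?r + pconst (y j) * q j"
      using insert.hyps by (simp add: ac_simps)
    have "L (?r + pconst (y j) * q j) = L ?r + y j * L (q j)"
      using functional_on_add[OF L r(1) jy] functional_on_scale[OF L j] by simp
    then show ?case
      unfolding eq using polys_le_add[OF r(1) jy] r(2) insert.hyps by simp
  qed
  then show "p + (\<Sum>i\<in>A. pconst (y i) * q i) \<in> polys_le U d"
    and "L (p + (\<Sum>i\<in>A. pconst (y i) * q i)) = L p + (\<Sum>i\<in>A. y i * L (q i))" by auto
qed

text \<open>The functional \<open>q \<mapsto> \<Sum>k. L k (prestrict (V k) q)\<close> is feasible for the dense relaxation. A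
  non-edge is not contained in a clique, so its monomial restricts to zero on every \<open>V k\<close>.\<close>

lemma xi_le_xi_isp:
  fixes E :: "'n::finite set set"
  assumes V: "\<And>k. k \<in> {1..p} \<Longrightarrow> clique E (V k)"
  shows "xi E m g N f a t \<le> xi_isp p V m g N f a t"
  unfolding xi_isp_def
proof (rule Inf_greatest, clarify)
  fix L assume fn: "\<forall>k\<in>{1..p}. functional_on (V k) (2 * t) (L k)"
    and mom: "\<forall>i\<in>{1..N}. (\<Sum>k=1..p. L k (prestrict (V k) (f i))) = a i"
    and pos: "\<forall>k\<in>{1..p}. \<forall>q\<in>trunc_quad_module (V k) m (\<lambda>j. prestrict (V k) (g j)) (2 * t). 0 \<le> L k q"
  define M where "M q = (\<Sum>k=1..p. L k (prestrict (V k) q))" for q :: "'n rpoly"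
  have res: "prestrict (V k) q \<in> polys_le (V k) (2 * t)" if "q \<in> polys_le UNIV (2 * t)" for k and q :: "'n rpoly"
    using that by (simp add: polys_le_def prestrict_in_polys pdeg_prestrict)
  have "functional_on UNIV (2 * t) M"
    unfolding functional_on_def
  proof (intro conjI ballI allI)
    fix q r :: "'n rpoly" assume "q \<in> polys_le UNIV (2 * t)" "r \<in> polys_le UNIV (2 * t)"
    then have "L k (prestrict (V k) (q + r)) = L k (prestrict (V k) q) + L k (prestrict (V k) r)"
      if "k \<in> {1..p}" for k
      using that fn res functional_on_add[of "V k" "2 * t" "L k"] by (simp add: prestrict_hom)
    then show "M (q + r) = M q + M r" unfolding M_def by (simp add: sum.distrib)
  next
    fix c and q :: "'n rpoly" assume "q \<in> polys_le UNIV (2 * t)"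
    then have "L k (prestrict (V k) (pconst c * q)) = c * L k (prestrict (V k) q)"
      if "k \<in> {1..p}" for k
      using that fn res functional_on_scale[of "V k" "2 * t" "L k"] by (simp add: prestrict_hom)
    then show "M (pconst c * q) = c * M q" unfolding M_def by (simp add: sum_distrib_left)
  qed
  moreover have "\<forall>i\<in>{1..N}. M (f i) = a i" using mom by (simp add: M_def)
  moreover have "\<forall>q\<in>trunc_quad_module UNIV m g (2 * t). 0 \<le> M q"
    unfolding M_def using pos trunc_quad_module_prestrict by (intro ballI sum_nonneg) blast
  moreover have "\<forall>q\<in>trunc_edge_ideal E (2 * t). M q = 0"
  proof
    fix q :: "'n rpoly" assume "q \<in> trunc_edge_ideal E (2 * t)"
    then obtain u where q: "q = (\<Sum>e\<in>nonedges E. u e * (\<Prod>i\<in>e. pvar i))"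
      unfolding trunc_edge_ideal_def by blast
    have "prestrict (V k) q = 0" if k: "k \<in> {1..p}" for k
    proof -
      have "prestrict (V k) (\<Prod>i\<in>e. pvar i) = 0" if e: "e \<in> nonedges E" for e
      proof -
        obtain i j where ij: "e = {i, j}" "i \<noteq> j" "{i, j} \<notin> E"
          using e unfolding nonedges_def by blast
        then have "i \<notin> V k \<or> j \<notin> V k" using V[OF k] unfolding clique_def by blast
        then show ?thesis using ij by (auto simp: prestrict_hom)
      qed
      then show ?thesis unfolding q by (simp add: prestrict_hom)
    qed
    moreover have "L k 0 = 0" if "k \<in> {1..p}" for k
      using fn that by (intro functional_on_zero) blast
    ultimately show "M q = 0" unfolding M_def by (intro sum.neutral) simp
  qed
  ultimately have "xi E m g N f a t \<le> ereal (M (f 0))"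
    unfolding xi_def by (intro Inf_lower CollectI exI[of _ M]) simp
  then show "xi E m g N f a t \<le> ereal (\<Sum>k=1..p. L k (prestrict (V k) (f 0)))"
    by (simp only: M_def)
qed

text \<open>Each atom is assigned to one clique \<open>V (\<kappa> x)\<close> that contains its support, and \<open>L k\<close> integrates over the
  atoms assigned to \<open>k\<close>. Every atom must be counted once although several \<open>V k\<close> may
  contain its support.\<close>

lemma xi_isp_le_gmp_val:
  fixes E :: "'n::finite set set"
  assumes V: "\<And>C. clique E C \<Longrightarrow> \<exists>k\<in>{1..p}. C \<subseteq> V k"
  shows "xi_isp p V m g N f a t \<le> gmp_val E m g N f a"
  unfolding gmp_val_eq_atomic
proof (rule Inf_greatest, clarify)
  fix T w assume at: "atomic_feasible E m g N f a T w"
  then have T: "finite T" "T \<subseteq> feas_set E m g" and w: "\<And>x. x \<in> T \<Longrightarrow> 0 \<le> w x"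
    and mom: "\<And>i. i \<in> {1..N} \<Longrightarrow> (\<Sum>x\<in>T. w x * peval x (f i)) = a i"
    unfolding atomic_feasible_def by auto
  have "\<forall>x\<in>T. \<exists>k\<in>{1..p}. {i. x $ i \<noteq> 0} \<subseteq> V k"
    using T(2) V feas_set_support_clique by blast
  then obtain \<kappa> where \<kappa>: "\<And>x. x \<in> T \<Longrightarrow> \<kappa> x \<in> {1..p}" "\<And>x. x \<in> T \<Longrightarrow> {i. x $ i \<noteq> 0} \<subseteq> V (\<kappa> x)"
    by metis
  define L where "L k q = (\<Sum>x\<in>{x \<in> T. \<kappa> x = k}. w x * peval x q)" for k q
  have ev: "peval x (prestrict (V (\<kappa> x)) q) = peval x q" if "x \<in> T" for x q
    using \<kappa>(2)[OF that] by (intro peval_prestrict) auto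
  have total: "(\<Sum>k=1..p. L k (prestrict (V k) q)) = (\<Sum>x\<in>T. w x * peval x q)" for q
  proof -
    have "L k (prestrict (V k) q) = (\<Sum>x\<in>{x \<in> T. \<kappa> x = k}. w x * peval x q)" for k
      unfolding L_def using ev by (intro sum.cong) auto
    moreover have "(\<Sum>k=1..p. \<Sum>x\<in>{x \<in> T. \<kappa> x = k}. w x * peval x q) = (\<Sum>x\<in>T. w x * peval x q)"
      using T(1) \<kappa>(1) by (intro sum.group) auto
    ultimately show ?thesis by simp
  qed
  have "functional_on (V k) (2 * t) (L k)" for k
    unfolding functional_on_def L_def
    by (simp add: peval_hom distrib_left sum.distrib sum_distrib_left mult.left_commute)
  moreover have "0 \<le> L k q"
    if q: "q \<in> trunc_quad_module (V k) m (\<lambda>j. prestrict (V k) (g j)) (2 * t)" for k q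
    unfolding L_def
  proof (rule sum_nonneg)
    fix x assume "x \<in> {x \<in> T. \<kappa> x = k}"
    then have x: "x \<in> T" "\<kappa> x = k" by auto
    have "\<forall>j\<in>{1..m}. 0 \<le> peval x (prestrict (V k) (g j))"
      using ev[OF x(1)] x T(2) unfolding feas_set_def by auto
    then have "0 \<le> peval x q"
      using q trunc_quad_module_subset by (intro peval_quad_module_nonneg) blast+
    then show "0 \<le> w x * peval x q" using w[OF x(1)] by simp
  qed
  ultimately have "xi_isp p V m g N f a t \<le> ereal (\<Sum>k=1..p. L k (prestrict (V k) (f 0)))"
    unfolding xi_isp_def using mom total by (intro Inf_lower CollectI exI[of _ L]) simp
  then show "xi_isp p V m g N f a t \<le> ereal (\<Sum>x\<in>T. w x * peval x (f 0))"
    by (simp only: total)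
qed

section \<open>Dual certificates and convergence\<close>

lemma sum_split_0: "(\<Sum>i=0..N. h i) = h 0 + (\<Sum>i=1..N. h i)" for h :: "nat \<Rightarrow> real"
  by (simp add: sum.atLeast_Suc_atMost)

lemma gmp_val_le_atomic:
  "atomic_feasible E m g N f a T w \<Longrightarrow> gmp_val E m g N f a \<le> ereal (\<Sum>x\<in>T. w x * peval x (f 0))"
  unfolding gmp_val_eq_atomic by (intro Inf_lower CollectI exI[of _ T] exI[of _ w] conjI refl)

text \<open>The weights \<open>u\<close> on \<open>X\<close>, together with \<open>\<alpha>\<close> and \<open>\<beta>\<close>, describe a vanishing nonnegative combination of
  moment vectors, \<open>(1, 0, \<dots>, 0)\<close> and \<open>- (c, a 1, \<dots>, a N)\<close>; it must be trivial. If
  \<open>\<beta> > 0\<close>, then \<open>u / \<beta>\<close> is feasible with objective at most \<open>c\<close>. If \<open>\<beta> = 0\<close> and \<open>X \<noteq> {}\<close>, then \<open>u\<close> has zero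
  moments and objective \<open>- \<alpha>\<close>; positivity of \<open>\<Sum>i. z i * f i\<close> on \<open>K\<close> gives \<open>z 0 * \<alpha> < 0\<close>, which is
  impossible for \<open>z 0 \<ge> 0\<close>, and otherwise \<open>u\<close> is a direction along which the objective of a feasible
  measure decreases without bound.\<close>

lemma moment_ray_excluded:
  fixes E :: "'n::finite set set"
  assumes c: "ereal c < gmp_val E m g N f a"
    and z: "\<And>x. x \<in> feas_set E m g \<Longrightarrow> 0 < (\<Sum>i=0..N. z i * peval x (f i))"
    and fin: "gmp_val E m g N f a < \<infinity> \<or> 0 \<le> z 0"
    and X: "finite X" "X \<subseteq> feas_set E m g" "\<And>x. x \<in> X \<Longrightarrow> 0 < u x" and ab: "0 \<le> \<alpha>" "0 \<le> \<beta>"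
    and obj: "(\<Sum>x\<in>X. u x * peval x (f 0)) + \<alpha> = \<beta> * c"
    and mom: "\<And>i. i \<in> {1..N} \<Longrightarrow> (\<Sum>x\<in>X. u x * peval x (f i)) = \<beta> * a i"
  shows "X = {} \<and> \<alpha> = 0 \<and> \<beta> = 0"
proof -
  have le: False if at: "atomic_feasible E m g N f a T w" and "(\<Sum>x\<in>T. w x * peval x (f 0)) \<le> c" for T w
  proof -
    note gmp_val_le_atomic[OF at]
    also have "ereal (\<Sum>x\<in>T. w x * peval x (f 0)) \<le> ereal c" using that(2) by simp
    finally show False using c by simp
  qed
  have scaled: "(\<Sum>x\<in>X. r * u x * q x) = r * (\<Sum>x\<in>X. u x * q x)" for r q
    by (simp add: sum_distrib_left mult.assoc)
  have \<beta>: "\<beta> = 0"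
  proof (rule ccontr)
    assume "\<beta> \<noteq> 0"
    then have \<beta>: "0 < \<beta>" using ab by simp
    show False
    proof (rule le[of X "\<lambda>x. 1 / \<beta> * u x"])
      show "atomic_feasible E m g N f a X (\<lambda>x. 1 / \<beta> * u x)"
        unfolding atomic_feasible_def scaled using X \<beta> mom by (auto simp: less_imp_le)
      have "(\<Sum>x\<in>X. u x * peval x (f 0)) \<le> \<beta> * c" using obj ab(1) by linarith
      then show "(\<Sum>x\<in>X. 1 / \<beta> * u x * peval x (f 0)) \<le> c"
        unfolding scaled using \<beta> by (simp add: field_simps)
    qed
  qed
  have X0: "X = {}"
  proof (rule ccontr)
    assume "X \<noteq> {}"
    then have "0 < (\<Sum>x\<in>X. u x * (\<Sum>i=0..N. z i * peval x (f i)))"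
    proof (rule sum_pos[OF X(1)])
      fix x assume "x \<in> X"
      then have "x \<in> feas_set E m g" using X(2) by blast
      then show "0 < u x * (\<Sum>i=0..N. z i * peval x (f i))"
        using X(3)[OF \<open>x \<in> X\<close>] z by (intro mult_pos_pos)
    qed
    also have "\<dots> = (\<Sum>x\<in>X. \<Sum>i=0..N. z i * (u x * peval x (f i)))"
      by (simp add: sum_distrib_left mult.left_commute)
    also have "\<dots> = (\<Sum>i=0..N. z i * (\<Sum>x\<in>X. u x * peval x (f i)))"
      by (subst sum.swap) (simp add: sum_distrib_left)
    also have "\<dots> = - (z 0 * \<alpha>)"
    proof -
      have "(\<Sum>x\<in>X. u x * peval x (f 0)) = - \<alpha>" using obj \<beta> by simp
      then show ?thesis unfolding sum_split_0 using mom \<beta> by simp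
    qed
    finally have neg: "z 0 * \<alpha> < 0" by simp
    then have "z 0 < 0" using ab(1) by (simp add: mult_less_0_iff)
    then have "gmp_val E m g N f a < \<infinity>" using fin by simp
    have \<alpha>: "0 < \<alpha>" using neg ab(1) by (auto simp: less_le)
    have "\<exists>T w. atomic_feasible E m g N f a T w"
    proof (rule ccontr)
      assume "\<not> ?thesis"
      then have "gmp_val E m g N f a = \<infinity>"
        unfolding gmp_val_eq_atomic by (simp add: top_ereal_def)
      with \<open>gmp_val E m g N f a < \<infinity>\<close> show False by simp
    qed
    then obtain T w where at: "atomic_feasible E m g N f a T w" by (elim exE)
    define o' where "o' = (\<Sum>x\<in>T. w x * peval x (f 0))"
    \<comment> \<open>Adding \<open>r\<close> times \<open>u\<close> lowers the objective \<open>o'\<close> by \<open>r * \<alpha>\<close>, enough to reach \<open>c\<close>.\<close>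
    define r where "r = max 0 ((o' - c) / \<alpha>)"
    define w' where "w' x = (if x \<in> T then w x else 0) + (if x \<in> X then r * u x else 0)" for x
    have T: "finite T" "T \<subseteq> feas_set E m g" "\<And>x. x \<in> T \<Longrightarrow> 0 \<le> w x"
      using at unfolding atomic_feasible_def by auto
    have r0: "0 \<le> r" "(o' - c) / \<alpha> \<le> r" by (simp_all add: r_def)
    then have r: "0 \<le> r" "o' - c \<le> r * \<alpha>" using \<alpha> by (simp_all add: pos_divide_le_eq)
    have sum: "(\<Sum>x\<in>T \<union> X. w' x * q x) = (\<Sum>x\<in>T. w x * q x) + r * (\<Sum>x\<in>X. u x * q x)" for q
    proof -
      have "(\<Sum>x\<in>T \<union> X. w' x * q x) =
          (\<Sum>x\<in>T \<union> X. if x \<in> T then w x * q x else 0) + (\<Sum>x\<in>T \<union> X. if x \<in> X then r * u x * q x else 0)"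
        unfolding sum.distrib[symmetric] w'_def by (intro sum.cong) (auto simp: algebra_simps)
      also have "(\<Sum>x\<in>T \<union> X. if x \<in> T then w x * q x else 0) = (\<Sum>x\<in>T. w x * q x)"
        using T(1) X(1) by (intro sum.mono_neutral_cong_right) auto
      also have "(\<Sum>x\<in>T \<union> X. if x \<in> X then r * u x * q x else 0) = (\<Sum>x\<in>X. r * u x * q x)"
        using T(1) X(1) by (intro sum.mono_neutral_cong_right) auto
      finally show ?thesis by (simp add: scaled)
    qed
    have "atomic_feasible E m g N f a (T \<union> X) w'"
      unfolding atomic_feasible_def sum
      using at T X r(1) mom \<beta> by (auto simp: atomic_feasible_def w'_def less_imp_le)
    moreover have "(\<Sum>x\<in>T \<union> X. w' x * peval x (f 0)) \<le> c"
    proof -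
      have "(\<Sum>x\<in>X. u x * peval x (f 0)) = - \<alpha>" using obj \<beta> by simp
      then show ?thesis unfolding sum using r(2) by (simp add: o'_def)
    qed
    ultimately show False by (rule le)
  qed
  with obj \<beta> show ?thesis by simp
qed

text \<open>Absence of a duality gap: every real number below the value of the moment problem is beaten
  by a dual solution \<open>y\<close>, and moreover by one whose constraint holds strictly on \<open>K\<close>, as Putinar's theorem
  requires. Including \<open>(1, 0, \<dots>, 0)\<close> among the vectors makes the coefficient of \<open>f 0\<close>
  positive, so that it can be normalised to \<open>1\<close>.\<close>

lemma strict_dual_certificate:
  fixes E :: "'n::finite set set"
  assumes K: "compact (feas_set E m g)"
    and c: "ereal c < gmp_val E m g N f a"
    and z: "\<And>x. x \<in> feas_set E m g \<Longrightarrow> 0 < (\<Sum>i=0..N. z i * peval x (f i))"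
    and fin: "gmp_val E m g N f a < \<infinity> \<or> 0 \<le> z 0"
  obtains y where "\<And>x. x \<in> feas_set E m g \<Longrightarrow> 0 < peval x (f 0) + (\<Sum>i=1..N. y i * peval x (f i))"
    "c < - (\<Sum>i=1..N. y i * a i)"
proof -
  let ?K = "feas_set E m g"
  define \<Phi> where "\<Phi> x = (\<lambda>i. peval x (f i))" for x
  define e0 :: "nat \<Rightarrow> real" where "e0 = (\<lambda>i. if i = 0 then 1 else 0)"
  define b' :: "nat \<Rightarrow> real" where "b' = (\<lambda>i. - (if i = 0 then c else a i))"
  define S where "S = \<Phi> ` ?K \<union> {e0, b'}"
  have "continuous_on ?K \<Phi>"
    unfolding \<Phi>_def by (intro continuous_on_coordinatewise_then_product continuous_intros)
  then have "compact S" unfolding S_def using K by (intro compact_Un compact_continuous_image) auto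
  have "\<not> positively_dependent {0..N} S (\<lambda>i v. v i)"
  proof
    assume "positively_dependent {0..N} S (\<lambda>i v. v i)"
    then obtain T w where T: "finite T" "T \<noteq> {}" "T \<subseteq> S" and w: "\<And>v. v \<in> T \<Longrightarrow> 0 < w v"
      and dep: "\<And>i. i \<in> {0..N} \<Longrightarrow> (\<Sum>v\<in>T. w v * v i) = 0"
      unfolding positively_dependent_def by blast
    define T1 where "T1 = T \<inter> \<Phi> ` ?K"
    define \<rho> where "\<rho> = inv_into ?K \<Phi>"
    define X where "X = \<rho> ` T1"
    have \<rho>: "\<rho> v \<in> ?K" "\<Phi> (\<rho> v) = v" if "v \<in> T1" for v
      using that unfolding T1_def \<rho>_def by (auto intro: inv_into_into f_inv_into_f)
    have inj: "inj_on \<rho> T1" by (rule inj_on_inverseI[of _ \<Phi>]) (rule \<rho>(2))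
    \<comment> \<open>Vectors that are moment vectors of points of \<open>K\<close> are attributed to \<open>T1\<close>.
      The two extra vectors count only if they are not of this kind, and only once if they coincide.\<close>
    define \<alpha> where "\<alpha> = (if e0 \<in> T - T1 then w e0 else 0)"
    define \<beta> where "\<beta> = (if b' \<in> T - T1 \<and> b' \<noteq> e0 then w b' else 0)"
    have sumX: "(\<Sum>x\<in>X. w (\<Phi> x) * peval x (f i)) = (\<Sum>v\<in>T1. w v * v i)" for i
    proof -
      have "(\<Sum>x\<in>X. w (\<Phi> x) * peval x (f i)) = (\<Sum>x\<in>X. w (\<Phi> x) * \<Phi> x i)" by (simp add: \<Phi>_def)
      also have "\<dots> = (\<Sum>v\<in>T1. w v * v i)"
        unfolding X_def by (simp add: sum.reindex[OF inj] \<rho>(2))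
      finally show ?thesis .
    qed
    have sum2: "(\<Sum>v\<in>T - T1. w v * v i) = \<alpha> * e0 i + \<beta> * b' i" for i
    proof -
      have "T - T1 \<subseteq> {e0, b'}" using T(3) unfolding T1_def S_def by blast
      then have "(\<Sum>v\<in>T - T1. w v * v i) = (\<Sum>v\<in>{e0, b'}. if v \<in> T - T1 then w v * v i else 0)"
        by (intro sum.mono_neutral_cong_left) auto
      also have "\<dots> = \<alpha> * e0 i + \<beta> * b' i"
        by (cases "e0 = b'") (auto simp: \<alpha>_def \<beta>_def)
      finally show ?thesis .
    qed
    have rel: "(\<Sum>x\<in>X. w (\<Phi> x) * peval x (f i)) + \<alpha> * e0 i + \<beta> * b' i = 0" if "i \<in> {0..N}" for i
    proof -
      have "(\<Sum>v\<in>T. w v * v i) = (\<Sum>v\<in>T - T1. w v * v i) + (\<Sum>v\<in>T1. w v * v i)"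
        using T(1) by (intro sum.subset_diff) (auto simp: T1_def)
      then show ?thesis using dep[OF that] sumX sum2 by simp
    qed
    have "X = {} \<and> \<alpha> = 0 \<and> \<beta> = 0"
    proof (rule moment_ray_excluded[OF c z fin])
      show "finite X" using T(1) by (simp add: X_def T1_def)
      show "X \<subseteq> ?K" using \<rho>(1) by (auto simp: X_def)
      show "0 < w (\<Phi> x)" if "x \<in> X" for x
        using that \<rho>(2) w by (auto simp: X_def T1_def)
      show "0 \<le> \<alpha>" "0 \<le> \<beta>" using w by (auto simp: \<alpha>_def \<beta>_def less_imp_le)
      show "(\<Sum>x\<in>X. w (\<Phi> x) * peval x (f 0)) + \<alpha> = \<beta> * c"
        using rel[of 0] by (simp add: e0_def b'_def)
      show "(\<Sum>x\<in>X. w (\<Phi> x) * peval x (f i)) = \<beta> * a i" if "i \<in> {1..N}" for i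
        using rel[of i] that by (simp add: e0_def b'_def)
    qed
    moreover from T(2) obtain v where v: "v \<in> T" by blast
    ultimately have "v \<notin> T1" "v \<noteq> e0" "v \<noteq> b'"
      using w[OF v] v by (auto simp: X_def \<alpha>_def \<beta>_def split: if_splits)
    then show False using v T(3) unfolding T1_def S_def by blast
  qed
  then obtain y where y: "\<And>v. v \<in> S \<Longrightarrow> 0 < (\<Sum>i=0..N. y i * v i)"
    using gordan_compact[OF finite_atLeastAtMost \<open>compact S\<close>, of "\<lambda>i v. v i" 0 N] by auto
  have y0: "0 < y 0"
    using y[of e0] unfolding sum_split_0 by (simp add: S_def e0_def)
  have scaled: "(\<Sum>i=1..N. y i / y 0 * h i) = (\<Sum>i=1..N. y i * h i) / y 0" for h
    by (simp add: sum_divide_distrib)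
  show ?thesis
  proof (rule that[of "\<lambda>i. y i / y 0"])
    fix x assume "x \<in> ?K"
    then have "0 < y 0 * peval x (f 0) + (\<Sum>i=1..N. y i * peval x (f i))"
      using y[of "\<Phi> x"] unfolding sum_split_0 by (simp add: S_def \<Phi>_def)
    then show "0 < peval x (f 0) + (\<Sum>i=1..N. y i / y 0 * peval x (f i))"
      unfolding scaled using y0 by (simp add: field_simps)
  next
    have "0 < y 0 * b' 0 + (\<Sum>i=1..N. y i * b' i)"
      using y[of b'] unfolding sum_split_0 by (simp add: S_def)
    moreover have "(\<Sum>i=1..N. y i * b' i) = - (\<Sum>i=1..N. y i * a i)"
      by (simp add: b'_def flip: sum_negf)
    ultimately have "0 < - (y 0 * c) - (\<Sum>i=1..N. y i * a i)" by (simp add: b'_def)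
    then show "c < - (\<Sum>i=1..N. y i / y 0 * a i)"
      unfolding scaled using y0 by (simp add: field_simps)
  qed
qed

text \<open>A strict dual solution is certified on every clique at some finite level, and from then on
  bounds the sparse relaxation from below.\<close>

lemma eventually_xi_isp_ge:
  fixes E :: "'n::finite set set"
  assumes arch: "archimedean_module m g" and V: "\<And>k. k \<in> {1..p} \<Longrightarrow> clique E (V k)"
    and y: "\<And>x. x \<in> feas_set E m g \<Longrightarrow> 0 < peval x (f 0) + (\<Sum>i=1..N. y i * peval x (f i))"
  shows "\<forall>\<^sub>F t in sequentially. ereal (- (\<Sum>i=1..N. y i * a i)) \<le> xi_isp p V m g N f a t"
proof -
  define h where "h = f 0 + (\<Sum>i=1..N. pconst (y i) * f i)"
  have "prestrict (V k) h \<in> quad_module (V k) m (\<lambda>j. prestrict (V k) (g j))" if k: "k \<in> {1..p}" for k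
  proof (rule putinar_prestrict[OF arch])
    fix x assume "\<And>i. i \<notin> V k \<Longrightarrow> x $ i = 0" "\<And>j. j \<in> {1..m} \<Longrightarrow> 0 \<le> peval x (g j)"
    then have "x \<in> feas_set E m g" by (rule clique_supported_feasible[OF V[OF k]])
    then show "0 < peval x h" using y by (simp add: h_def peval_hom)
  qed
  then have "\<forall>\<^sub>F t in sequentially. \<forall>k\<in>{1..p}.
      prestrict (V k) h \<in> trunc_quad_module (V k) m (\<lambda>j. prestrict (V k) (g j)) (2 * t)"
    by (intro eventually_ball_finite ballI eventually_trunc_quad_module) auto
  moreover have "\<forall>\<^sub>F t in sequentially. \<forall>i\<in>{0..N}. pdeg (f i) \<le> 2 * t"
  proof (intro eventually_ball_finite ballI)
    fix i
    show "\<forall>\<^sub>F t in sequentially. pdeg (f i) \<le> 2 * t"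
      using eventually_ge_at_top[of "pdeg (f i)"] by (rule eventually_mono) simp
  qed simp
  ultimately show ?thesis
  proof eventually_elim
    case (elim t)
    show ?case
      unfolding xi_isp_def
    proof (rule Inf_greatest, clarify)
      fix L assume fn: "\<forall>k\<in>{1..p}. functional_on (V k) (2 * t) (L k)"
        and mom: "\<forall>i\<in>{1..N}. (\<Sum>k=1..p. L k (prestrict (V k) (f i))) = a i"
        and pos: "\<forall>k\<in>{1..p}. \<forall>q\<in>trunc_quad_module (V k) m (\<lambda>j. prestrict (V k) (g j)) (2 * t). 0 \<le> L k q"
      have "L k (prestrict (V k) h) = L k (prestrict (V k) (f 0)) + (\<Sum>i=1..N. y i * L k (prestrict (V k) (f i)))"
        if "k \<in> {1..p}" for k
      proof -
        have "prestrict (V k) h = prestrict (V k) (f 0) + (\<Sum>i=1..N. pconst (y i) * prestrict (V k) (f i))"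
          by (simp add: h_def prestrict_hom)
        then show ?thesis
          using fn that elim(2) functional_on_combination(2)[of "V k" "2 * t" "L k" "{1..N}"
            "prestrict (V k) (f 0)" "\<lambda>i. prestrict (V k) (f i)" y]
          by (simp add: polys_le_prestrict)
      qed
      then have "(\<Sum>k=1..p. L k (prestrict (V k) h)) = (\<Sum>k=1..p. L k (prestrict (V k) (f 0))) +
          (\<Sum>k=1..p. \<Sum>i=1..N. y i * L k (prestrict (V k) (f i)))"
        by (simp add: sum.distrib)
      also have "(\<Sum>k=1..p. \<Sum>i=1..N. y i * L k (prestrict (V k) (f i))) = (\<Sum>i=1..N. y i * a i)"
        by (subst sum.swap) (use mom in \<open>simp add: sum_distrib_left[symmetric]\<close>)
      finally have "(\<Sum>k=1..p. L k (prestrict (V k) h)) =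
          (\<Sum>k=1..p. L k (prestrict (V k) (f 0))) + (\<Sum>i=1..N. y i * a i)" .
      moreover have "0 \<le> (\<Sum>k=1..p. L k (prestrict (V k) h))"
        using pos elim(1) by (intro sum_nonneg) blast
      ultimately show "ereal (- (\<Sum>i=1..N. y i * a i)) \<le> ereal (\<Sum>k=1..p. L k (prestrict (V k) (f 0)))"
        by simp
    qed
  qed
qed

theorem theorem7:
  fixes E :: "'n::finite set set"
    and V :: "nat \<Rightarrow> 'n set"
    and f g :: "nat \<Rightarrow> 'n rpoly"
    and a :: "nat \<Rightarrow> real"
    and p N m :: nat
  assumes graph: "\<forall>e\<in>E. \<exists>i j. i \<noteq> j \<and> e = {i, j}"
    and cliques: "bij_betw V {1..p} (max_cliques E)"
  shows "(\<forall>t\<ge>1. (\<forall>i\<in>{0..N}. pdeg (f i) \<le> 2 * t) \<longrightarrow>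
            xi E m g N f a t \<le> xi_isp p V m g N f a t \<and>
            xi_isp p V m g N f a t \<le> gmp_val E m g N f a) \<and>
         (archimedean_module m g \<longrightarrow>
          (\<exists>z :: nat \<Rightarrow> real.
             (\<forall>x\<in>feas_set E m g. 0 < (\<Sum>i=0..N. z i * peval x (f i))) \<and>
             (gmp_val E m g N f a < \<infinity> \<or> 0 \<le> z 0)) \<longrightarrow>
          (\<lambda>t. xi_isp p V m g N f a t) \<longlonglongrightarrow> gmp_val E m g N f a)"
proof -
  have clique: "clique E (V k)" if "k \<in> {1..p}" for k
  proof -
    have "V k \<in> max_cliques E" using bij_betwE[OF cliques] that by blast
    then show ?thesis unfolding max_cliques_def by blast
  qed
  have cover: "\<exists>k\<in>{1..p}. C \<subseteq> V k" if C: "clique E C" for C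
  proof -
    obtain D where D: "D \<in> max_cliques E" "C \<subseteq> D" using clique_subset_max_clique[OF C] by blast
    then obtain k where "k \<in> {1..p}" "D = V k" using bij_betw_imp_surj_on[OF cliques] by blast
    with D(2) show ?thesis by blast
  qed
  have lower: "xi E m g N f a t \<le> xi_isp p V m g N f a t" for t
    by (rule xi_le_xi_isp[OF clique])
  have upper: "xi_isp p V m g N f a t \<le> gmp_val E m g N f a" for t
    by (rule xi_isp_le_gmp_val[OF cover])
  have "(\<lambda>t. xi_isp p V m g N f a t) \<longlonglongrightarrow> gmp_val E m g N f a"
    if arch: "archimedean_module m g" and z: "\<forall>x\<in>feas_set E m g. 0 < (\<Sum>i=0..N. z i * peval x (f i))"
      and fin: "gmp_val E m g N f a < \<infinity> \<or> 0 \<le> z 0" for z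
  proof (rule order_tendstoI)
    fix l assume "l < gmp_val E m g N f a"
    then obtain c where c: "l < ereal c" "ereal c < gmp_val E m g N f a"
      using ereal_dense2 by blast
    obtain y where y: "\<And>x. x \<in> feas_set E m g \<Longrightarrow> 0 < peval x (f 0) + (\<Sum>i=1..N. y i * peval x (f i))"
      "c < - (\<Sum>i=1..N. y i * a i)"
      using strict_dual_certificate[OF compact_feas_set[OF arch] c(2) z[rule_format] fin] by blast
    have "\<forall>\<^sub>F t in sequentially. ereal (- (\<Sum>i=1..N. y i * a i)) \<le> xi_isp p V m g N f a t"
      using arch clique y(1) by (rule eventually_xi_isp_ge)
    moreover have "l < ereal (- (\<Sum>i=1..N. y i * a i))"
      using c(1) y(2) by (metis ereal_less_eq(3) less_imp_le order_less_le_trans)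
    ultimately show "\<forall>\<^sub>F t in sequentially. l < xi_isp p V m g N f a t"
      by (auto elim!: eventually_mono intro: less_le_trans)
  next
    fix u assume "gmp_val E m g N f a < u"
    then show "\<forall>\<^sub>F t in sequentially. xi_isp p V m g N f a t < u"
      using upper by (intro always_eventually allI) (rule le_less_trans)
  qed
  with lower upper show ?thesis by blast
qed

end
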